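(* Let $\mathcal{O}\subset\mathbb{R}^4$ be open with coordinates $(u_1,u_2,u_3,u_4)$, and let $a,b,c\in C^\infty(\mathcal{O})$ depend only on $(u_1,u_2)$. Consider the Walker metric $g_{a,b,c}$ whose matrix in the coordinate frame is $$(g_{a,b,c})_{ij}=\begin{pmatrix}0&0&1&0\\0&0&0&1\\1&0&a&c\\0&1&c&b\end{pmatrix}.$$ Then $g_{a,b,c}$ is locally conformally flat if and only if \begin{align*} a&=\tfrac{I}{2}u_1^2+Ju_1+Eu_1u_2+Fu_2+K,\\ b&=-\tfrac{I}{2}u_2^2+Lu_2+Mu_1u_2+Nu_1+R,\\ c&=\tfrac{M}{2}u_1^2+Pu_1+\tfrac{E}{2}u_2^2+Gu_2+(Q+H), \end{align*} where $E,F,G,H,I,J,K,L,M,N,P,Q,R$ are constants satisfying \begin{align*} 0&=EN-JM+IP,\\ 0&=EL-FM+IG,\\ 0&=ER-KM+I(H+Q),\\ 0&=K(LP-NG)+R(JG-FP)+(Q+H)(FN-JL). \end{align*}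
   Context: A pseudo-Riemannian manifold is locally conformally flat if and only if its Weyl conformal curvature tensor vanishes, where for dimension $n$ the Weyl tensor is $W(X,Y,Z,T)=R(X,Y,Z,T)+\frac{Sc}{(n-1)(n-2)}\{g(Y,Z)g(X,T)-g(X,Z)g(Y,T)\}+\frac{1}{n-2}\{\rho(Y,Z)g(X,T)-\rho(X,Z)g(Y,T)-\rho(Y,T)g(X,Z)+\rho(X,T)g(Y,Z)\}$, with $\rho$ the Ricci tensor and $Sc$ the scalar curvature.
   Formalization: The open set O is assumed nonempty and connected; on a disconnected O the constants may differ between components, so the "only if" direction with a single set of constants fails. *)

theory Defs
  imports "HOL-Analysis.Analysis"
begin

definition partial :: "'n::finite \<Rightarrow> (real^'n \<Rightarrow> real) \<Rightarrow> real^'n \<Rightarrow> real" where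
  "partial k f x = deriv (\<lambda>t. f (x + t *\<^sub>R axis k 1)) 0"

primrec iter_partial :: "'n::finite list \<Rightarrow> (real^'n \<Rightarrow> real) \<Rightarrow> real^'n \<Rightarrow> real" where
  "iter_partial [] f = f"
| "iter_partial (k # ks) f = partial k (iter_partial ks f)"

definition smooth_on :: "(real^'n::finite) set \<Rightarrow> (real^'n \<Rightarrow> real) \<Rightarrow> bool" where
  "smooth_on Om f \<longleftrightarrow> (\<forall>ks. iter_partial ks f differentiable_on Om)"

type_synonym 'n metric = "real^'n \<Rightarrow> 'n \<Rightarrow> 'n \<Rightarrow> real"

definition metric_matrix :: "'n::finite metric \<Rightarrow> real^'n \<Rightarrow> real^'n^'n" where
  "metric_matrix g x = (\<chi> i j. g x i j)"

definition pseudo_riemannian_on :: "(real^'n::finite) set \<Rightarrow> 'n metric \<Rightarrow> bool" where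
  "pseudo_riemannian_on Om g \<longleftrightarrow> open Om \<and>
     (\<forall>i j. smooth_on Om (\<lambda>x. g x i j)) \<and>
     (\<forall>x\<in>Om. \<forall>i j. g x i j = g x j i) \<and>
     (\<forall>x\<in>Om. det (metric_matrix g x) \<noteq> 0)"

definition inv_metric :: "'n::finite metric \<Rightarrow> 'n metric" where
  "inv_metric g x i j = matrix_inv (metric_matrix g x) $ i $ j"

definition christoffel :: "'n::finite metric \<Rightarrow> 'n \<Rightarrow> 'n \<Rightarrow> 'n \<Rightarrow> real^'n \<Rightarrow> real" where
  "christoffel g k i j x = (1/2) * (\<Sum>l\<in>UNIV. inv_metric g x k l *
      (partial i (\<lambda>y. g y j l) x + partial j (\<lambda>y. g y i l) x - partial l (\<lambda>y. g y i j) x))"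

text \<open>Riemann curvature tensor R^l_{ijk} (components of R(d_i,d_j)d_k).\<close>
definition riemann :: "'n::finite metric \<Rightarrow> 'n \<Rightarrow> 'n \<Rightarrow> 'n \<Rightarrow> 'n \<Rightarrow> real^'n \<Rightarrow> real" where
  "riemann g l i j k x =
     partial i (christoffel g l j k) x - partial j (christoffel g l i k) x
     + (\<Sum>m\<in>UNIV. christoffel g l i m x * christoffel g m j k x
                 - christoffel g l j m x * christoffel g m i k x)"

definition flat_on :: "(real^'n::finite) set \<Rightarrow> 'n metric \<Rightarrow> bool" where
  "flat_on U g \<longleftrightarrow> (\<forall>x\<in>U. \<forall>l i j k. riemann g l i j k x = 0)"

definition locally_conformally_flat :: "(real^'n::finite) set \<Rightarrow> 'n metric \<Rightarrow> bool" where
  "locally_conformally_flat Om g \<longleftrightarrow>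
     (\<forall>p\<in>Om. \<exists>U \<sigma>. open U \<and> p \<in> U \<and> U \<subseteq> Om \<and> smooth_on U \<sigma> \<and>
        flat_on U (\<lambda>x i j. exp (2 * \<sigma> x) * g x i j))"

definition walker_metric :: "(real^4 \<Rightarrow> real) \<Rightarrow> (real^4 \<Rightarrow> real) \<Rightarrow> (real^4 \<Rightarrow> real) \<Rightarrow> 4 metric" where
  "walker_metric a b c x i j =
     (if (i = 1 \<and> j = 3) \<or> (i = 3 \<and> j = 1) \<or> (i = 2 \<and> j = 4) \<or> (i = 4 \<and> j = 2) then 1
      else if i = 3 \<and> j = 3 then a x
      else if i = 4 \<and> j = 4 then b x
      else if (i = 3 \<and> j = 4) \<or> (i = 4 \<and> j = 3) then c x
      else 0)"

definition depends_only_on_u1u2 :: "(real^4) set \<Rightarrow> (real^4 \<Rightarrow> real) \<Rightarrow> bool" where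
  "depends_only_on_u1u2 Om f \<longleftrightarrow>
     (\<forall>x\<in>Om. \<forall>y\<in>Om. x $ 1 = y $ 1 \<and> x $ 2 = y $ 2 \<longrightarrow> f x = f y)"

end

theory Submission
  imports Defs
begin

text \<open>If \<open>e\<^bsup>2\<sigma>\<^esup> g\<close> is flat, then the curvature of \<open>g\<close> is the Kulkarni-Nomizu product of \<open>g\<close> with a
  tensor built from the Hessian of \<open>\<sigma>\<close>. Eliminating that tensor leaves linear equations in the second
  derivatives of \<open>a, b, c\<close>, which force all their third derivatives to vanish, and two more equations: with
  \<open>n = (- M, E, I)\<close> and \<open>v = (a, b, c)\<close>, they say that \<open>n \<bullet> v = 0\<close> and that \<open>v, \<partial>\<^sub>1 v, \<partial>\<^sub>2 v\<close> are
  linearly dependent. The first one gives three of the conditions on the constants. If \<open>n = 0\<close>, then \<open>v\<close> is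
  affine and the second one is the fourth condition; otherwise it follows from the first one.

  Conversely, \<open>\<sigma> = - ln \<phi>\<close> works as soon as \<open>\<phi>\<close> solves a linear second order equation and a quadratic
  first order one. We take \<open>\<phi> = \<alpha> + \<beta> u\<^sub>1 + \<gamma> u\<^sub>2\<close> to be the pairing of two local twistors. These solve
  a linear system with constant coefficients in \<open>u\<^sub>3, u\<^sub>4\<close> whose two matrices commute exactly because of the
  four conditions, hence exist by the matrix exponential; the quadratic equation is then the Pluecker relation.\<close>

section \<open>Partial derivatives\<close>

text \<open>Conformal flatness is defined by the existence of a factor, so the converse has to
  produce one. Flatness of the rescaled metric prescribes the conformal Hessian of \<sigma>, which
  must be the Schouten tensor of the metric: an overdetermined nonlinear system. Writing \<sigma> =
  - ln \<phi> makes its Hessian part linear. The Christoffel symbols with both lower indices in {1,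
  2} vanish, and so do the prescribed components 11, 12, 22; this forces \<phi> to be affine in
  \<open>u $ 1\<close>, \<open>u $ 2\<close>, with coefficients depending on \<open>u $ 3\<close>,
  \<open>u $ 4\<close>. Prolonging the system gives six unknown functions, the components of a
  standard tractor. The signature is (2,2), so by the covering of SO(3,3) by SL(4,R) the tractors
  are the bivectors of a real bundle of rank 4, the local twistors, and the tractor norm is the
  Pluecker quadric. Working in rank 4 reduces integrability to one commutator of 4 by 4 matrices,
  and the quadratic equation holds identically for a wedge product.\<close>

lemma partial_eqI:
  assumes "(f has_derivative f') (at x)"
  shows "partial k f x = f' (axis k 1)"
proof -
  have "((\<lambda>t::real. x + t *\<^sub>R axis k 1) has_derivative (\<lambda>t. t *\<^sub>R axis k 1)) (at 0)"
    by (auto intro!: derivative_eq_intros)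
  moreover have "(f has_derivative f') (at (x + 0 *\<^sub>R axis k 1))"
    using assms by simp
  ultimately have "((\<lambda>t. f (x + t *\<^sub>R axis k 1)) has_derivative (\<lambda>t. f' (t *\<^sub>R axis k 1))) (at 0)"
    by (rule has_derivative_compose)
  moreover have "f' (t *\<^sub>R axis k 1) = f' (axis k 1) * t" for t
    using has_derivative_linear[OF assms] by (simp add: linear_scale)
  ultimately have "((\<lambda>t. f (x + t *\<^sub>R axis k 1)) has_real_derivative f' (axis k 1)) (at 0)"
    by (simp add: has_field_derivative_def)
  then show ?thesis
    unfolding partial_def by (rule DERIV_imp_deriv)
qed

lemma frechet_derivative_axis:
  "f differentiable (at x) \<Longrightarrow> frechet_derivative f (at x) (axis k 1) = partial k f x"
  by (simp add: frechet_derivative_works partial_eqI)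

lemma has_derivative_partial:
  fixes f :: "real^'n \<Rightarrow> real"
  assumes "f differentiable (at x)"
  shows "(f has_derivative (\<lambda>h. \<Sum>k\<in>UNIV. h $ k * partial k f x)) (at x)"
proof -
  let ?D = "frechet_derivative f (at x)"
  have D: "(f has_derivative ?D) (at x)"
    using assms by (simp add: frechet_derivative_works)
  have lin: "linear ?D"
    using D by (rule has_derivative_linear)
  have "?D h = (\<Sum>k\<in>UNIV. h $ k * partial k f x)" for h
  proof -
    have "?D h = ?D (\<Sum>k\<in>UNIV. h $ k *\<^sub>R axis k 1)"
      using basis_expansion[of h] by (simp add: scalar_mult_eq_scaleR)
    then show ?thesis
      using assms by (simp add: linear_sum[OF lin] linear_scale[OF lin] frechet_derivative_axis)
  qed
  then show ?thesis
    using D by (metis (no_types, lifting) ext)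
qed

lemma partial_cong_open:
  assumes "open U" "x \<in> U" "\<And>y. y \<in> U \<Longrightarrow> f y = g y"
  shows "partial k f x = partial k g x"
proof -
  have "open ((\<lambda>t. x + t *\<^sub>R axis k 1) -` U)"
    by (intro open_vimage continuous_intros assms)
  then have "\<forall>\<^sub>F t in nhds (0::real). x + t *\<^sub>R axis k 1 \<in> U"
    using \<open>x \<in> U\<close> by (auto simp: eventually_nhds)
  then have "\<forall>\<^sub>F t in nhds 0. f (x + t *\<^sub>R axis k 1) = g (x + t *\<^sub>R axis k 1)"
    by eventually_elim (use assms in auto)
  then show ?thesis
    unfolding partial_def by (intro deriv_cong_ev) auto
qed

lemma partial_const [simp]: "partial k (\<lambda>x. c) x = 0"
  by (simp add: partial_def)

lemma partial_component [simp]: "partial k (\<lambda>x. x $ i) x = (if k = i then 1 else 0)"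
  using partial_eqI[OF bounded_linear_imp_has_derivative[OF bounded_linear_vec_nth], of k i x]
  by (simp add: axis_def)

lemma partial_add:
  assumes "f differentiable (at x)" "g differentiable (at x)"
  shows "partial k (\<lambda>x. f x + g x) x = partial k f x + partial k g x"
  using partial_eqI[OF has_derivative_add[OF assms(1)[unfolded frechet_derivative_works] assms(2)[unfolded frechet_derivative_works]], of k]
  by (simp add: assms frechet_derivative_axis)

lemma partial_minus:
  assumes "f differentiable (at x)"
  shows "partial k (\<lambda>x. - f x) x = - partial k f x"
  using partial_eqI[OF has_derivative_minus[OF assms[unfolded frechet_derivative_works]], of k]
  by (simp add: assms frechet_derivative_axis)

lemma partial_diff:
  assumes "f differentiable (at x)" "g differentiable (at x)"
  shows "partial k (\<lambda>x. f x - g x) x = partial k f x - partial k g x"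
  using partial_eqI[OF has_derivative_diff[OF assms(1)[unfolded frechet_derivative_works] assms(2)[unfolded frechet_derivative_works]], of k]
  by (simp add: assms frechet_derivative_axis)

lemma partial_mult:
  assumes "f differentiable (at x)" "g differentiable (at x)"
  shows "partial k (\<lambda>x. f x * g x) x = f x * partial k g x + partial k f x * g x"
  using partial_eqI[OF has_derivative_mult[OF assms(1)[unfolded frechet_derivative_works] assms(2)[unfolded frechet_derivative_works]], of k]
  by (simp add: assms frechet_derivative_axis)

lemma partial_divide_const:
  assumes "f differentiable (at x)"
  shows "partial k (\<lambda>x. f x / c) x = partial k f x / c"
  using partial_mult[OF assms, of "\<lambda>_. inverse c"] by (simp add: divide_inverse)

lemma partial_power2:
  assumes "f differentiable (at x)"
  shows "partial k (\<lambda>x. (f x)\<^sup>2) x = 2 * f x * partial k f x"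
  using partial_mult[OF assms assms] by (simp add: power2_eq_square)

lemma partial_sum:
  assumes "\<And>i. i \<in> S \<Longrightarrow> f i differentiable (at x)"
  shows "partial k (\<lambda>x. \<Sum>i\<in>S. f i x) x = (\<Sum>i\<in>S. partial k (f i) x)"
proof -
  have "((\<lambda>x. \<Sum>i\<in>S. f i x) has_derivative (\<lambda>h. \<Sum>i\<in>S. frechet_derivative (f i) (at x) h)) (at x)"
    using assms by (intro has_derivative_sum) (simp add: frechet_derivative_works)
  from partial_eqI[OF this] show ?thesis
    using assms by (simp add: frechet_derivative_axis)
qed

lemma partial_compose:
  assumes "(h has_real_derivative h') (at (f x))" "f differentiable (at x)"
  shows "partial k (\<lambda>x. h (f x)) x = h' * partial k f x"
proof -
  have "((\<lambda>x. h (f x)) has_derivative (\<lambda>v. h' * frechet_derivative f (at x) v)) (at x)"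
    using has_derivative_compose[of f "frechet_derivative f (at x)" x UNIV h "(*) h'"] assms
    by (simp add: frechet_derivative_works has_field_derivative_def)
  from partial_eqI[OF this] show ?thesis
    using assms by (simp add: frechet_derivative_axis)
qed

lemma differentiable_compose_real:
  fixes f :: "'a::real_normed_vector \<Rightarrow> real"
  assumes "(h has_real_derivative h') (at (f x))" "f differentiable (at x)"
  shows "(\<lambda>x. h (f x)) differentiable (at x)"
proof -
  have "(f has_derivative frechet_derivative f (at x)) (at x)"
    using assms(2) by (simp add: frechet_derivative_works)
  from has_derivative_compose[OF this assms(1)[unfolded has_field_derivative_def]] show ?thesis
    by (rule differentiableI)
qed

lemma differentiable_component [simp]: "(\<lambda>x::real^'n. x $ i) differentiable F"
  by (simp add: bounded_linear_imp_differentiable bounded_linear_vec_nth)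

lemma differentiable_cong_open:
  assumes "open U" "x \<in> U" "\<And>y. y \<in> U \<Longrightarrow> f y = g y" "g differentiable (at x)"
  shows "f differentiable (at x)"
  using assms unfolding differentiable_def
  by (metis has_derivative_transform_within_open)

text \<open>Young's form of the symmetry theorem. The second difference \<open>\<Delta> h\<close> is
  symmetric in \<open>i\<close> and \<open>j\<close>, and divided by the square of \<open>h\<close>
  it tends to either iterated derivative: the mean value theorem in direction \<open>i\<close> leads
  to a difference of values of \<open>partial i f\<close>, which the linear approximation at
  \<open>x\<close> evaluates.\<close>

lemma partial_commute:
  fixes f :: "real^'n \<Rightarrow> real"
  assumes "open U" "x \<in> U" and f: "\<And>y. y \<in> U \<Longrightarrow> f differentiable (at y)"
    and fi: "partial i f differentiable (at x)" and fj: "partial j f differentiable (at x)"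
  shows "partial i (partial j f) x = partial j (partial i f) x"
proof -
  define \<Delta> where "\<Delta> h = f (x + h *\<^sub>R axis i 1 + h *\<^sub>R axis j 1) - f (x + h *\<^sub>R axis i 1)
    - f (x + h *\<^sub>R axis j 1) + f x" for h :: real
  have main: "((\<lambda>h. (f (x + h *\<^sub>R axis i 1 + h *\<^sub>R axis j 1) - f (x + h *\<^sub>R axis i 1)
    - f (x + h *\<^sub>R axis j 1) + f x) / h\<^sup>2) \<longlongrightarrow> partial j (partial i f) x) (at_right 0)"
    if fi: "partial i f differentiable (at x)" for i j
  proof -
    obtain r where r: "r > 0" "ball x r \<subseteq> U"
      using assms openE by blast
    have line: "((\<lambda>t. f (z + t *\<^sub>R axis i 1)) has_real_derivative partial i f (z + t *\<^sub>R axis i 1)) (at t)"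
      if "z + t *\<^sub>R axis i 1 \<in> U" for z t
    proof -
      have *: "((\<lambda>t. z + t *\<^sub>R axis i 1) has_derivative (\<lambda>t. t *\<^sub>R axis i 1)) (at t)"
        by (auto intro!: derivative_eq_intros)
      have "(f has_derivative frechet_derivative f (at (z + t *\<^sub>R axis i 1))) (at (z + t *\<^sub>R axis i 1))"
        using f[OF that] frechet_derivative_works by blast
      from has_derivative_compose[OF * this]
      show ?thesis
        using linear_frechet_derivative[OF f[OF that]] frechet_derivative_axis[OF f[OF that]]
        by (simp add: has_field_derivative_def linear_scale mult_commute_abs)
    qed
    let ?L = "\<lambda>h. \<Sum>k\<in>UNIV. h $ k * partial k (partial i f) x"
    have L: "(partial i f has_derivative ?L) (at x)"
      using fi by (rule has_derivative_partial)
    have linL: "linear ?L"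
      using L by (rule has_derivative_linear)
    have Lj: "?L (axis j 1) = partial j (partial i f) x"
      by (simp add: axis_def if_distrib[of "\<lambda>x. x * _"] cong: if_cong)
    show ?thesis
      unfolding tendsto_iff dist_real_def
    proof (intro allI impI)
      \<comment> \<open>The two remainders are taken at distance at most \<open>2 * h\<close> and
        \<open>h\<close> from \<open>x\<close>, so with \<open>e / 4\<close> they add up to at most
        \<open>3/4 * e * h\<close>, strictly below \<open>e * h\<close>. The factor 2 is also why
        \<open>s\<close> is half of the smaller radius.\<close>
      fix e :: real assume "e > 0"
      then have "e / 4 > 0" by simp
      then obtain d where d: "d > 0"
        "\<And>y. norm (y - x) < d \<Longrightarrow> norm (partial i f y - partial i f x - ?L (y - x)) \<le> e/4 * norm (y - x)"
        using L unfolding has_derivative_at_alt by blast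
      define s where "s = min d r / 2"
      have s: "s > 0" using d r by (simp add: s_def)
      show "\<forall>\<^sub>F h in at_right 0. \<bar>(f (x + h *\<^sub>R axis i 1 + h *\<^sub>R axis j 1) - f (x + h *\<^sub>R axis i 1)
          - f (x + h *\<^sub>R axis j 1) + f x) / h\<^sup>2 - partial j (partial i f) x\<bar> < e"
        unfolding eventually_at_right_field
      proof (intro exI[of _ s] conjI s allI impI)
        fix h :: real assume h: "h > 0" "h < s"
        have nrm: "norm (t *\<^sub>R axis i 1 + u *\<^sub>R axis j (1::real)) \<le> t + u" if "0 \<le> t" "0 \<le> u" for t u
          using norm_triangle_ineq[of "t *\<^sub>R axis i (1::real)" "u *\<^sub>R axis j 1"] that by (simp add: norm_axis_1)
        have inU: "x + t *\<^sub>R axis i 1 + u *\<^sub>R axis j 1 \<in> U" if "0 \<le> t" "t \<le> h" "0 \<le> u" "u \<le> h" for t u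
        proof -
          have "norm (t *\<^sub>R axis i 1 + u *\<^sub>R axis j (1::real)) < r"
            using nrm[of t u] that h by (simp add: s_def)
          then have "x + (t *\<^sub>R axis i 1 + u *\<^sub>R axis j 1) \<in> ball x r"
            using norm_minus_cancel[of "t *\<^sub>R axis i (1::real) + u *\<^sub>R axis j 1"] by (simp add: dist_norm)
          with r show ?thesis by (auto simp: add.assoc)
        qed
        define F where "F t = f ((x + h *\<^sub>R axis j 1) + t *\<^sub>R axis i 1) - f (x + t *\<^sub>R axis i 1)" for t
        have FD: "(F has_real_derivative (partial i f ((x + h *\<^sub>R axis j 1) + t *\<^sub>R axis i 1)
            - partial i f (x + t *\<^sub>R axis i 1))) (at t)" if "0 \<le> t" "t \<le> h" for t
          unfolding F_def
          using inU[of t h] inU[of t 0] that h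
          by (intro DERIV_diff line) (simp_all add: algebra_simps)
        then obtain t where t: "0 < t" "t < h" "F h - F 0 = (h - 0) *
            (partial i f ((x + h *\<^sub>R axis j 1) + t *\<^sub>R axis i 1) - partial i f (x + t *\<^sub>R axis i 1))"
          using MVT2[OF h(1) FD] by blast
        let ?y = "(x + h *\<^sub>R axis j 1) + t *\<^sub>R axis i 1" and ?z = "x + t *\<^sub>R axis i 1"
        have y: "?y - x = t *\<^sub>R axis i 1 + h *\<^sub>R axis j 1" and z: "?z - x = t *\<^sub>R axis i 1 + 0 *\<^sub>R axis j 1"
          by (simp_all add: algebra_simps)
        have ny: "norm (?y - x) \<le> 2 * h" and nz: "norm (?z - x) \<le> h"
          unfolding y z using nrm[of t h] nrm[of t 0] t h by simp_all
        have "norm (?y - x) < d" "norm (?z - x) < d"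
          using ny nz h by (auto simp: s_def)
        then have "\<bar>partial i f ?y - partial i f x - ?L (?y - x)\<bar> \<le> e/4 * norm (?y - x)"
          "\<bar>partial i f ?z - partial i f x - ?L (?z - x)\<bar> \<le> e/4 * norm (?z - x)"
          using d(2) unfolding real_norm_def by blast+
        moreover have "e/4 * norm (?y - x) \<le> e/4 * (2 * h)" "e/4 * norm (?z - x) \<le> e/4 * h"
          using ny nz \<open>e > 0\<close> by (intro mult_left_mono; simp)+
        moreover have "?L (?y - x) - ?L (?z - x) = h * partial j (partial i f) x"
        proof -
          have "?L (?y - x) - ?L (?z - x) = ?L ((?y - x) - (?z - x))"
            using linear_diff[OF linL, of "?y - x" "?z - x"] by simp
          also have "(?y - x) - (?z - x) = h *\<^sub>R axis j 1" by simp
          also have "?L (h *\<^sub>R axis j 1) = h * ?L (axis j 1)"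
            using linear_scale[OF linL, of h "axis j 1"] by simp
          finally show ?thesis by (simp only: Lj)
        qed
        ultimately have "\<bar>(partial i f ?y - partial i f ?z) - h * partial j (partial i f) x\<bar> \<le> e/4 * (2 * h) + e/4 * h"
          by linarith
        moreover have "e/4 * (2 * h) + e/4 * h < e * h"
          using mult_pos_pos[OF \<open>e > 0\<close> h(1)] by (simp add: field_simps)
        ultimately have b: "\<bar>(partial i f ?y - partial i f ?z) - h * partial j (partial i f) x\<bar> < e * h"
          by linarith
        have "f (x + h *\<^sub>R axis i 1 + h *\<^sub>R axis j 1) - f (x + h *\<^sub>R axis i 1) - f (x + h *\<^sub>R axis j 1) + f x = F h - F 0"
          unfolding F_def by (simp add: algebra_simps)
        then have "(f (x + h *\<^sub>R axis i 1 + h *\<^sub>R axis j 1) - f (x + h *\<^sub>R axis i 1) - f (x + h *\<^sub>R axis j 1) + f x) / h\<^sup>2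
            - partial j (partial i f) x = (h - 0) * (partial i f ?y - partial i f ?z) / h\<^sup>2 - partial j (partial i f) x"
          by (simp only: t(3))
        also have "\<dots> = ((partial i f ?y - partial i f ?z) - h * partial j (partial i f) x) / h"
          using h by (simp add: power2_eq_square diff_divide_distrib)
        finally have "(f (x + h *\<^sub>R axis i 1 + h *\<^sub>R axis j 1) - f (x + h *\<^sub>R axis i 1) - f (x + h *\<^sub>R axis j 1) + f x) / h\<^sup>2
            - partial j (partial i f) x = ((partial i f ?y - partial i f ?z) - h * partial j (partial i f) x) / h" .
        then show "\<bar>(f (x + h *\<^sub>R axis i 1 + h *\<^sub>R axis j 1) - f (x + h *\<^sub>R axis i 1) - f (x + h *\<^sub>R axis j 1) + f x) / h\<^sup>2
            - partial j (partial i f) x\<bar> < e"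
          using b h by (simp add: abs_divide divide_less_eq)
      qed
    qed
  qed
  have "((\<lambda>h. \<Delta> h / h\<^sup>2) \<longlongrightarrow> partial j (partial i f) x) (at_right 0)"
    using main[OF fi, of j] by (simp add: \<Delta>_def)
  moreover have "((\<lambda>h. \<Delta> h / h\<^sup>2) \<longlongrightarrow> partial i (partial j f) x) (at_right 0)"
    using main[OF fj, of i] by (simp add: \<Delta>_def algebra_simps)
  ultimately show ?thesis
    using tendsto_unique trivial_limit_at_right_real by blast
qed

lemma partial_zero_imp_constant:
  fixes f :: "real^'n \<Rightarrow> real"
  assumes "open U" "connected U" "\<And>x. x \<in> U \<Longrightarrow> f differentiable (at x)"
    and "\<And>x k. x \<in> U \<Longrightarrow> partial k f x = 0"
  shows "\<exists>c. \<forall>x\<in>U. f x = c"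
proof (cases "U = {}")
  case False
  then obtain z where "z \<in> U" by blast
  have "(f has_derivative (\<lambda>h. 0)) (at x)" if "x \<in> U" for x
    using has_derivative_partial[OF assms(3)[OF that]] assms(4)[OF that] by simp
  then have "f x = f z" if "x \<in> U" for x
    using has_derivative_zero_unique_connected[OF assms(1,2)] that \<open>z \<in> U\<close> by metis
  then show ?thesis by blast
qed auto

section \<open>Smooth functions\<close>

text \<open>\<open>iter_partial\<close> peels off the outermost derivative; passing from
  \<open>f\<close> to \<open>partial k f\<close> needs the innermost one.\<close>

lemma iter_partial_snoc: "iter_partial (ks @ [k]) f = iter_partial ks (partial k f)"
  by (induction ks) auto

lemma smooth_on_partial: "smooth_on U f \<Longrightarrow> smooth_on U (partial k f)"
  unfolding smooth_on_def by (metis iter_partial_snoc)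

lemma smooth_on_imp_differentiable:
  assumes "smooth_on U f" "open U" "x \<in> U"
  shows "f differentiable (at x)"
proof -
  have "f differentiable_on U"
    using assms(1) unfolding smooth_on_def by (metis iter_partial.simps(1))
  then show ?thesis
    using assms by (simp add: differentiable_on_eq_differentiable_at)
qed

lemma smooth_on_subset: "smooth_on U f \<Longrightarrow> V \<subseteq> U \<Longrightarrow> smooth_on V f"
  unfolding smooth_on_def using differentiable_on_subset by blast

lemma smooth_on_partial_commute:
  assumes "smooth_on U f" "open U" "x \<in> U"
  shows "partial i (partial j f) x = partial j (partial i f) x"
  using assms by (intro partial_commute[of U]) (auto intro: smooth_on_imp_differentiable smooth_on_partial)

inductive_set generated_algebra :: "('a \<Rightarrow> real) set \<Rightarrow> ('a \<Rightarrow> real) set" for G where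
  gen: "f \<in> G \<Longrightarrow> f \<in> generated_algebra G"
| const: "(\<lambda>x. c) \<in> generated_algebra G"
| add: "f \<in> generated_algebra G \<Longrightarrow> g \<in> generated_algebra G \<Longrightarrow> (\<lambda>x. f x + g x) \<in> generated_algebra G"
| mult: "f \<in> generated_algebra G \<Longrightarrow> g \<in> generated_algebra G \<Longrightarrow> (\<lambda>x. f x * g x) \<in> generated_algebra G"

text \<open>Differentiating the generators once is enough: the sum and product rules keep all
  iterated partials inside the algebra, up to equality on the open set \<open>U\<close>, which
  partial derivatives respect. This handles functions known only through a differential system that
  they solve.\<close>

lemma smooth_on_generated_algebra:
  fixes G :: "(real^'n \<Rightarrow> real) set"
  assumes "open U"
    and diff: "\<And>f x. f \<in> G \<Longrightarrow> x \<in> U \<Longrightarrow> f differentiable (at x)"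
    and part: "\<And>f k. f \<in> G \<Longrightarrow> \<exists>g\<in>generated_algebra G. \<forall>x\<in>U. partial k f x = g x"
    and f: "f \<in> generated_algebra G"
  shows "smooth_on U f"
proof -
  have D: "f differentiable (at x)" if "f \<in> generated_algebra G" "x \<in> U" for f x
    using that by induction (auto intro: diff)
  have P: "\<exists>g\<in>generated_algebra G. \<forall>x\<in>U. partial k f x = g x" if "f \<in> generated_algebra G" for f k
    using that
  proof induction
    case (gen f)
    then show ?case by (rule part)
  next
    case (const c)
    show ?case by (rule bexI[OF _ generated_algebra.const[of 0]]) simp
  next
    case (add f g)
    then obtain f' g' where "f' \<in> generated_algebra G" "g' \<in> generated_algebra G"
      "\<forall>x\<in>U. partial k f x = f' x" "\<forall>x\<in>U. partial k g x = g' x" by blast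
    then show ?case
      using add by (intro bexI[OF _ generated_algebra.add[of f' G g']]) (auto simp: partial_add D)
  next
    case (mult f g)
    then obtain f' g' where "f' \<in> generated_algebra G" "g' \<in> generated_algebra G"
      "\<forall>x\<in>U. partial k f x = f' x" "\<forall>x\<in>U. partial k g x = g' x" by blast
    then show ?case
      using mult by (intro bexI[OF _ generated_algebra.add[OF generated_algebra.mult[of f G g']
            generated_algebra.mult[of f' G g]]]) (auto simp: partial_mult D)
  qed
  have "\<exists>g\<in>generated_algebra G. \<forall>x\<in>U. iter_partial ks f x = g x" for ks
  proof (induction ks)
    case Nil
    then show ?case using f by auto
  next
    case (Cons k ks)
    then obtain g where g: "g \<in> generated_algebra G" "\<And>x. x \<in> U \<Longrightarrow> iter_partial ks f x = g x" by blast
    obtain g' where g': "g' \<in> generated_algebra G" "\<forall>x\<in>U. partial k g x = g' x"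
      using P[OF g(1)] by blast
    have "iter_partial (k # ks) f x = g' x" if "x \<in> U" for x
      using partial_cong_open[OF \<open>open U\<close> that g(2)] g'(2) that by simp
    with g' show ?case by blast
  qed
  then show ?thesis
    unfolding smooth_on_def differentiable_on_eq_differentiable_at[OF \<open>open U\<close>]
    by (metis D assms(1) differentiable_cong_open)
qed

section \<open>Curvature under a conformal change\<close>

lemma matrix_inv_eqI:
  fixes A :: "real^'n^'n"
  assumes "A ** B = mat 1"
  shows "matrix_inv A = B"
proof -
  have "B ** A = mat 1"
    using assms matrix_left_right_inverse by blast
  then have "A ** matrix_inv A = mat 1 \<and> matrix_inv A ** A = mat 1"
    unfolding matrix_inv_def using assms by (rule_tac someI[of _ B]) simp
  then show ?thesis
    using \<open>B ** A = mat 1\<close> by (metis matrix_mul_assoc matrix_mul_lid matrix_mul_rid)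
qed

definition kronecker :: "'n \<Rightarrow> 'n \<Rightarrow> real" where
  "kronecker i j = (if i = j then 1 else 0)"

lemma sum_kronecker [simp]:
  fixes f :: "'n::finite \<Rightarrow> real"
  shows "(\<Sum>m\<in>UNIV. kronecker i m * f m) = f i" "(\<Sum>m\<in>UNIV. kronecker m i * f m) = f i"
    "(\<Sum>m\<in>UNIV. f m * kronecker i m) = f i" "(\<Sum>m\<in>UNIV. f m * kronecker m i) = f i"
  by (simp_all add: kronecker_def if_distrib[of "\<lambda>x. x * _"] if_distrib[of "(*) _"] cong: if_cong)

definition gradient :: "'n::finite metric \<Rightarrow> (real^'n \<Rightarrow> real) \<Rightarrow> 'n \<Rightarrow> real^'n \<Rightarrow> real" where
  "gradient g \<sigma> l x = (\<Sum>m\<in>UNIV. inv_metric g x l m * partial m \<sigma> x)"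

text \<open>In dimension at least 3 this is the amount by which the Schouten tensor drops when the
  metric is multiplied by \<open>exp (2 * \<sigma> x)\<close>. If the new metric is flat, it is
  therefore the Schouten tensor of the old one.\<close>

definition conformal_hessian :: "'n::finite metric \<Rightarrow> (real^'n \<Rightarrow> real) \<Rightarrow> 'n \<Rightarrow> 'n \<Rightarrow> real^'n \<Rightarrow> real" where
  "conformal_hessian g \<sigma> i j x =
     partial i (partial j \<sigma>) x - (\<Sum>k\<in>UNIV. christoffel g k i j x * partial k \<sigma> x)
     - partial i \<sigma> x * partial j \<sigma> x
     + (1/2) * (\<Sum>k\<in>UNIV. partial k \<sigma> x * gradient g \<sigma> k x) * g x i j"

text \<open>Differentiability of the inverse and of the Christoffel symbols is postulated rather
  than derived from smoothness of \<open>g\<close>: a Walker metric has an explicit inverse, so both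
  are checked there by components.\<close>

locale metric_on =
  fixes U :: "(real^'n::finite) set" and g :: "'n metric"
  assumes open_U: "open U"
    and metric_differentiable: "x \<in> U \<Longrightarrow> (\<lambda>x. g x i j) differentiable (at x)"
    and inv_metric_differentiable: "x \<in> U \<Longrightarrow> (\<lambda>x. inv_metric g x i j) differentiable (at x)"
    and christoffel_differentiable: "x \<in> U \<Longrightarrow> christoffel g l i j differentiable (at x)"
    and metric_sym: "x \<in> U \<Longrightarrow> g x i j = g x j i"
    and nondegenerate: "x \<in> U \<Longrightarrow> det (metric_matrix g x) \<noteq> 0"
begin

lemma metric_inv:
  assumes "x \<in> U"
  shows "metric_matrix g x ** matrix_inv (metric_matrix g x) = mat 1"
    and "matrix_inv (metric_matrix g x) ** metric_matrix g x = mat 1"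
proof -
  obtain B where B: "metric_matrix g x ** B = mat 1"
    using nondegenerate[OF assms] by (metis invertible_def invertible_det_nz)
  with matrix_inv_eqI[OF B] show "metric_matrix g x ** matrix_inv (metric_matrix g x) = mat 1"
    by simp
  then show "matrix_inv (metric_matrix g x) ** metric_matrix g x = mat 1"
    using matrix_left_right_inverse by blast
qed

lemma sum_inv_metric:
  assumes "x \<in> U"
  shows "(\<Sum>k\<in>UNIV. g x i k * inv_metric g x k j) = kronecker i j"
    and "(\<Sum>k\<in>UNIV. inv_metric g x i k * g x k j) = kronecker i j"
  using arg_cong[OF metric_inv(1)[OF assms], of "\<lambda>A. A $ i $ j"]
    arg_cong[OF metric_inv(2)[OF assms], of "\<lambda>A. A $ i $ j"]
  by (simp_all add: matrix_matrix_mult_def metric_matrix_def inv_metric_def mat_def kronecker_def)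

lemma christoffel_sym:
  assumes "x \<in> U"
  shows "christoffel g l i j x = christoffel g l j i x"
proof -
  have "partial m (\<lambda>y. g y i j) x = partial m (\<lambda>y. g y j i) x" for m
    using open_U assms metric_sym by (rule partial_cong_open)
  then show ?thesis
    unfolding christoffel_def by (simp add: algebra_simps)
qed

lemma lower_christoffel:
  assumes "x \<in> U"
  shows "(\<Sum>k\<in>UNIV. g x l k * christoffel g k i j x) =
    (partial i (\<lambda>y. g y j l) x + partial j (\<lambda>y. g y i l) x - partial l (\<lambda>y. g y i j) x) / 2"
proof -
  let ?X = "\<lambda>m. partial i (\<lambda>y. g y j m) x + partial j (\<lambda>y. g y i m) x - partial m (\<lambda>y. g y i j) x"
  have "(\<Sum>k\<in>UNIV. g x l k * christoffel g k i j x)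
      = (\<Sum>k\<in>UNIV. \<Sum>m\<in>UNIV. g x l k * inv_metric g x k m * (?X m / 2))"
    unfolding christoffel_def by (simp add: sum_distrib_left mult_ac)
  also have "\<dots> = (\<Sum>m\<in>UNIV. (\<Sum>k\<in>UNIV. g x l k * inv_metric g x k m) * (?X m / 2))"
    unfolding sum_distrib_right by (rule sum.swap)
  also have "\<dots> = ?X l / 2"
    unfolding sum_inv_metric[OF assms] by (rule sum_kronecker)
  finally show ?thesis .
qed

lemma lower_raise:
  assumes "x \<in> U"
  shows "(\<Sum>l\<in>UNIV. g x m l * (\<Sum>k\<in>UNIV. inv_metric g x l k * v k)) = v m"
    and "(\<Sum>l\<in>UNIV. inv_metric g x m l * (\<Sum>k\<in>UNIV. g x l k * v k)) = v m"
proof -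
  have "(\<Sum>l\<in>UNIV. g x m l * (\<Sum>k\<in>UNIV. inv_metric g x l k * v k))
      = (\<Sum>k\<in>UNIV. (\<Sum>l\<in>UNIV. g x m l * inv_metric g x l k) * v k)"
    unfolding sum_distrib_left sum_distrib_right mult.assoc by (rule sum.swap)
  then show "(\<Sum>l\<in>UNIV. g x m l * (\<Sum>k\<in>UNIV. inv_metric g x l k * v k)) = v m"
    by (simp add: sum_inv_metric assms)
  have "(\<Sum>l\<in>UNIV. inv_metric g x m l * (\<Sum>k\<in>UNIV. g x l k * v k))
      = (\<Sum>k\<in>UNIV. (\<Sum>l\<in>UNIV. inv_metric g x m l * g x l k) * v k)"
    unfolding sum_distrib_left sum_distrib_right mult.assoc by (rule sum.swap)
  then show "(\<Sum>l\<in>UNIV. inv_metric g x m l * (\<Sum>k\<in>UNIV. g x l k * v k)) = v m"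
    by (simp add: sum_inv_metric assms)
qed

end

section \<open>Transformation of the connection and the curvature under rescaling\<close>

locale conformal_change = metric_on +
  fixes \<sigma> :: "real^'a \<Rightarrow> real"
  assumes smooth_\<sigma>: "smooth_on U \<sigma>"
begin

abbreviation conf :: "'a metric" where
  "conf \<equiv> \<lambda>x i j. exp (2 * \<sigma> x) * g x i j"

lemma differentiable_\<sigma> [simp]:
  assumes "x \<in> U"
  shows "\<sigma> differentiable (at x)" "partial i \<sigma> differentiable (at x)"
  using smooth_on_imp_differentiable[OF _ open_U assms] smooth_\<sigma> smooth_on_partial by blast+

lemma lower_gradient:
  assumes "x \<in> U"
  shows "(\<Sum>l\<in>UNIV. g x m l * gradient g \<sigma> l x) = partial m \<sigma> x"
  unfolding gradient_def by (rule lower_raise(1)[OF assms])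

lemma inv_metric_conf:
  assumes "x \<in> U"
  shows "inv_metric conf x i j = exp (- 2 * \<sigma> x) * inv_metric g x i j"
proof -
  have "metric_matrix conf x = exp (2 * \<sigma> x) *\<^sub>R metric_matrix g x"
    by (simp add: metric_matrix_def vec_eq_iff)
  then have "metric_matrix conf x ** (exp (- 2 * \<sigma> x) *\<^sub>R matrix_inv (metric_matrix g x))
      = (exp (2 * \<sigma> x) * exp (- 2 * \<sigma> x)) *\<^sub>R mat 1"
    using metric_inv(1)[OF assms] by (simp add: matrix_scalar_ac scalar_matrix_assoc[symmetric])
  also have "exp (2 * \<sigma> x) * exp (- 2 * \<sigma> x) = 1"
    by (simp add: exp_add[symmetric])
  finally show ?thesis
    by (simp add: inv_metric_def matrix_inv_eqI)
qed

lemma partial_conf: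
  assumes "x \<in> U"
  shows "partial k (\<lambda>y. conf y i j) x
    = exp (2 * \<sigma> x) * (2 * partial k \<sigma> x * g x i j + partial k (\<lambda>y. g y i j) x)"
proof -
  have "((\<lambda>t. exp (2 * t)) has_real_derivative 2 * exp (2 * \<sigma> x)) (at (\<sigma> x))"
    by (auto intro!: derivative_eq_intros)
  note exp = partial_compose[OF this differentiable_\<sigma>(1)[OF assms], of k]
    differentiable_compose_real[OF this differentiable_\<sigma>(1)[OF assms]]
  show ?thesis
    unfolding partial_mult[OF exp(2) metric_differentiable[OF assms]] exp(1)
    by (simp add: algebra_simps)
qed

lemma christoffel_conf:
  assumes "x \<in> U"
  shows "christoffel conf l i j x = christoffel g l i j x
    + kronecker l i * partial j \<sigma> x + kronecker l j * partial i \<sigma> x - g x i j * gradient g \<sigma> l x"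
proof -
  have e: "exp (- 2 * \<sigma> x) * exp (2 * \<sigma> x) = 1"
    by (simp add: exp_add[symmetric])
  have "christoffel conf l i j x = (1/2) * (\<Sum>m\<in>UNIV. (exp (- 2 * \<sigma> x) * exp (2 * \<sigma> x)) * (inv_metric g x l m *
      (partial i (\<lambda>y. g y j m) x + partial j (\<lambda>y. g y i m) x - partial m (\<lambda>y. g y i j) x
        + 2 * partial i \<sigma> x * g x m j + 2 * partial j \<sigma> x * g x m i - 2 * partial m \<sigma> x * g x i j)))"
    unfolding christoffel_def partial_conf[OF assms] inv_metric_conf[OF assms]
  proof (intro arg_cong[of _ _ "(*) (1/2)"] sum.cong refl, goal_cases)
    case (1 m)
    show ?case
      unfolding metric_sym[OF assms, of m j] metric_sym[OF assms, of m i] by (simp only: algebra_simps)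
  qed
  also have "\<dots> = christoffel g l i j x
      + partial i \<sigma> x * (\<Sum>m\<in>UNIV. inv_metric g x l m * g x m j)
      + partial j \<sigma> x * (\<Sum>m\<in>UNIV. inv_metric g x l m * g x m i) - g x i j * gradient g \<sigma> l x"
    unfolding e christoffel_def gradient_def
    by (simp add: sum_distrib_left sum.distrib sum_subtractf algebra_simps)
  finally show ?thesis
    by (simp add: sum_inv_metric[OF assms])
qed

text \<open>Compatibility of the Levi-Civita connection with the metric, in coordinates.\<close>

lemma partial_metric:
  assumes "x \<in> U"
  shows "partial i (\<lambda>y. g y m l) x
    = (\<Sum>k\<in>UNIV. g x l k * christoffel g k i m x) + (\<Sum>k\<in>UNIV. g x m k * christoffel g k i l x)"
proof -
  have sym: "partial k (\<lambda>y. g y i j) x = partial k (\<lambda>y. g y j i) x" for k i j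
    using open_U assms metric_sym by (rule partial_cong_open)
  show ?thesis
    unfolding lower_christoffel[OF assms]
    using sym[of i l m] sym[of m i l] sym[of l m i] by (simp add: field_simps)
qed

lemma gradient_differentiable:
  assumes "x \<in> U"
  shows "gradient g \<sigma> l differentiable (at x)"
  unfolding gradient_def[abs_def] using inv_metric_differentiable[OF assms] differentiable_\<sigma>(2)[OF assms]
  by (intro differentiable_sum differentiable_mult) auto

text \<open>Differentiating the relation between \<open>d\<sigma>\<close> and its gradient avoids the derivative of the inverse metric.\<close>

lemma covariant_gradient:
  assumes "x \<in> U"
  shows "partial i (gradient g \<sigma> l) x + (\<Sum>k\<in>UNIV. christoffel g l i k x * gradient g \<sigma> k x)
    = (\<Sum>m\<in>UNIV. inv_metric g x l m *
        (partial i (partial m \<sigma>) x - (\<Sum>k\<in>UNIV. christoffel g k i m x * partial k \<sigma> x)))"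
proof -
  let ?S = "\<lambda>l. gradient g \<sigma> l x" and ?G = "\<lambda>l i j. christoffel g l i j x"
  have "partial i (partial m \<sigma>) x - (\<Sum>k\<in>UNIV. ?G k i m * partial k \<sigma> x)
    = (\<Sum>l\<in>UNIV. g x m l * (partial i (gradient g \<sigma> l) x + (\<Sum>k\<in>UNIV. ?G l i k * ?S k)))" for m
  proof -
    have "partial i (partial m \<sigma>) x = partial i (\<lambda>y. \<Sum>l\<in>UNIV. g y m l * gradient g \<sigma> l y) x"
      using open_U assms by (rule partial_cong_open) (simp add: lower_gradient)
    also have "\<dots> = (\<Sum>l\<in>UNIV. g x m l * partial i (gradient g \<sigma> l) x + partial i (\<lambda>y. g y m l) x * ?S l)"
      using assms by (subst partial_sum)
        (auto intro!: sum.cong partial_mult differentiable_mult metric_differentiable gradient_differentiable)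
    also have "\<dots> = (\<Sum>l\<in>UNIV. g x m l * partial i (gradient g \<sigma> l) x)
        + (\<Sum>l\<in>UNIV. \<Sum>k\<in>UNIV. g x k l * ?G k i m * ?S l) + (\<Sum>l\<in>UNIV. \<Sum>k\<in>UNIV. g x m k * ?G k i l * ?S l)"
      unfolding partial_metric[OF assms]
      using metric_sym[OF assms] by (simp add: sum.distrib distrib_right sum_distrib_right)
    also have "(\<Sum>l\<in>UNIV. \<Sum>k\<in>UNIV. g x k l * ?G k i m * ?S l) = (\<Sum>k\<in>UNIV. ?G k i m * (\<Sum>l\<in>UNIV. g x k l * ?S l))"
      unfolding sum_distrib_left by (subst sum.swap) (simp add: mult_ac)
    also have "\<dots> = (\<Sum>k\<in>UNIV. ?G k i m * partial k \<sigma> x)"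
      by (simp add: lower_gradient[OF assms])
    also have "(\<Sum>l\<in>UNIV. \<Sum>k\<in>UNIV. g x m k * ?G k i l * ?S l) = (\<Sum>k\<in>UNIV. g x m k * (\<Sum>l\<in>UNIV. ?G k i l * ?S l))"
      unfolding sum_distrib_left by (subst sum.swap) (simp add: mult_ac)
    finally show ?thesis
      by (simp add: distrib_left sum.distrib)
  qed
  then show ?thesis
    by (simp add: lower_raise(2)[OF assms])
qed

text \<open>Brings the raised tensor into the form in which it appears when
  \<open>christoffel_conf\<close> is differentiated: there it is the gradient, not the differential,
  that gets a derivative.\<close>

lemma raised_conformal_hessian:
  assumes "x \<in> U"
  shows "(\<Sum>m\<in>UNIV. inv_metric g x l m * conformal_hessian g \<sigma> i m x)
    = partial i (gradient g \<sigma> l) x + (\<Sum>k\<in>UNIV. christoffel g l i k x * gradient g \<sigma> k x)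
      - partial i \<sigma> x * gradient g \<sigma> l x
      + (1/2) * (\<Sum>k\<in>UNIV. partial k \<sigma> x * gradient g \<sigma> k x) * kronecker l i"
proof -
  let ?n = "\<Sum>k\<in>UNIV. partial k \<sigma> x * gradient g \<sigma> k x"
  let ?H = "\<lambda>m. partial i (partial m \<sigma>) x - (\<Sum>k\<in>UNIV. christoffel g k i m x * partial k \<sigma> x)"
  have "(\<Sum>m\<in>UNIV. inv_metric g x l m * conformal_hessian g \<sigma> i m x)
      = (\<Sum>m\<in>UNIV. inv_metric g x l m * ?H m - partial i \<sigma> x * (inv_metric g x l m * partial m \<sigma> x)
          + (1/2) * ?n * (inv_metric g x l m * g x m i))"
  proof (intro sum.cong refl, goal_cases)
    case (1 m)
    show ?case
      unfolding conformal_hessian_def metric_sym[OF assms, of m i] by (simp add: algebra_simps)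
  qed
  also have "\<dots> = (\<Sum>m\<in>UNIV. inv_metric g x l m * ?H m) - partial i \<sigma> x * gradient g \<sigma> l x
      + (1/2) * ?n * (\<Sum>m\<in>UNIV. inv_metric g x l m * g x m i)"
    unfolding gradient_def by (simp only: sum.distrib sum_subtractf sum_distrib_left)
  finally show ?thesis
    unfolding covariant_gradient[OF assms] sum_inv_metric[OF assms] .
qed

text \<open>The quadratic part of the curvature of a deformed connection, freed from the geometry:
  all letters are arbitrary, so only Kronecker symbols have to be contracted.\<close>

lemma sum_deformed_connection:
  fixes G G' :: "'a \<Rightarrow> real"
  shows "(\<Sum>m\<in>UNIV. (G m + kronecker l i * s m + kronecker l m * s i - gi m * S l)
      * (G' m + kronecker m j * s k + kronecker m k * s j - gjk * S m))
    = (\<Sum>m\<in>UNIV. G m * G' m) + s k * G j + s j * G k - gjk * (\<Sum>m\<in>UNIV. G m * S m)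
      + kronecker l i * (\<Sum>m\<in>UNIV. G' m * s m) + 2 * kronecker l i * s j * s k
      - kronecker l i * gjk * (\<Sum>m\<in>UNIV. s m * S m)
      + s i * G' l + s i * s k * kronecker l j + s i * s j * kronecker l k - s i * gjk * S l
      - S l * (\<Sum>m\<in>UNIV. gi m * G' m) - S l * s k * gi j - S l * s j * gi k + S l * gjk * (\<Sum>m\<in>UNIV. gi m * S m)"
proof -
  have "(G m + kronecker l i * s m + kronecker l m * s i - gi m * S l)
      * (G' m + kronecker m j * s k + kronecker m k * s j - gjk * S m)
    = G m * G' m + s k * (G m * kronecker m j) + s j * (G m * kronecker m k) - gjk * (G m * S m)
      + kronecker l i * (G' m * s m) + (kronecker l i * s k) * (s m * kronecker m j)
      + (kronecker l i * s j) * (s m * kronecker m k) - (kronecker l i * gjk) * (s m * S m)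
      + s i * (kronecker l m * G' m) + (s i * s k) * (kronecker l m * kronecker m j)
      + (s i * s j) * (kronecker l m * kronecker m k) - (s i * gjk) * (kronecker l m * S m)
      - S l * (gi m * G' m) - (S l * s k) * (gi m * kronecker m j) - (S l * s j) * (gi m * kronecker m k)
      + (S l * gjk) * (gi m * S m)" for m
    by (simp add: algebra_simps)
  then show ?thesis
    by (simp add: sum.distrib sum_subtractf sum_distrib_left[symmetric])
qed

theorem riemann_conf:
  assumes x: "x \<in> U"
  shows "riemann conf l i j k x = riemann g l i j k x
    + kronecker l j * conformal_hessian g \<sigma> i k x - kronecker l i * conformal_hessian g \<sigma> j k x
    + g x i k * (\<Sum>m\<in>UNIV. inv_metric g x l m * conformal_hessian g \<sigma> j m x)
    - g x j k * (\<Sum>m\<in>UNIV. inv_metric g x l m * conformal_hessian g \<sigma> i m x)"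
proof -
  let ?G = "\<lambda>l i j. christoffel g l i j x" and ?s = "\<lambda>i. partial i \<sigma> x" and ?S = "\<lambda>l. gradient g \<sigma> l x"
  have dG: "partial i (christoffel conf l j k) x = partial i (christoffel g l j k) x
      + kronecker l j * partial i (partial k \<sigma>) x + kronecker l k * partial i (partial j \<sigma>) x
      - (g x j k * partial i (gradient g \<sigma> l) x + partial i (\<lambda>y. g y j k) x * ?S l)" for l i j k
  proof -
    have "partial i (christoffel conf l j k) x = partial i (\<lambda>y. christoffel g l j k y
      + kronecker l j * partial k \<sigma> y + kronecker l k * partial j \<sigma> y - g y j k * gradient g \<sigma> l y) x"
      using open_U x christoffel_conf by (rule partial_cong_open)
    then show ?thesis
      using x by (simp add: partial_add partial_diff partial_mult christoffel_differentiable
          metric_differentiable gradient_differentiable)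
  qed
  have GG: "(\<Sum>m\<in>UNIV. christoffel conf l i m x * christoffel conf m j k x)
    = (\<Sum>m\<in>UNIV. ?G l i m * ?G m j k) + ?s k * ?G l i j + ?s j * ?G l i k - g x j k * (\<Sum>m\<in>UNIV. ?G l i m * ?S m)
      + kronecker l i * (\<Sum>m\<in>UNIV. ?G m j k * ?s m) + 2 * kronecker l i * ?s j * ?s k
      - kronecker l i * g x j k * (\<Sum>m\<in>UNIV. ?s m * ?S m)
      + ?s i * ?G l j k + ?s i * ?s k * kronecker l j + ?s i * ?s j * kronecker l k - ?s i * g x j k * ?S l
      - ?S l * (\<Sum>m\<in>UNIV. g x i m * ?G m j k) - ?S l * ?s k * g x i j - ?S l * ?s j * g x i k + ?S l * g x j k * ?s i"
    for l i j k
    using sum_deformed_connection[where G="\<lambda>m. ?G l i m" and l=l and i=i and s="?s" and gi="\<lambda>m. g x i m"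
        and S="?S" and G'="\<lambda>m. ?G m j k" and j=j and k=k and gjk="g x j k"]
    by (simp only: christoffel_conf[OF x] lower_gradient[OF x])
  have sym: "partial k (\<lambda>y. g y i j) x = partial k (\<lambda>y. g y j i) x" for k i j
    using open_U x metric_sym by (rule partial_cong_open)
  \<comment> \<open>Both sides are now expressed by Christoffel symbols and derivatives of
    \<open>g\<close>, \<sigma> and its gradient. Orienting every symmetric expression in one way
    lets the terms symmetric in \<open>i\<close> and \<open>j\<close> cancel in the
    antisymmetrization.\<close>
  show ?thesis
    unfolding raised_conformal_hessian[OF x] riemann_def sum_subtractf dG GG
    unfolding conformal_hessian_def lower_christoffel[OF x]
      smooth_on_partial_commute[OF smooth_\<sigma> open_U x, of j i]
      christoffel_sym[OF x, of l j i] metric_sym[OF x, of j i] sym[of k j i] sym[of j i k] sym[of i j k]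
    by (simp add: field_simps)
qed

end

section \<open>Curvature of Walker metrics\<close>

lemma walker_metric_simps [simp]:
  "walker_metric a b c x 1 1 = 0" "walker_metric a b c x 1 2 = 0"
  "walker_metric a b c x 1 3 = 1" "walker_metric a b c x 1 4 = 0"
  "walker_metric a b c x 2 1 = 0" "walker_metric a b c x 2 2 = 0"
  "walker_metric a b c x 2 3 = 0" "walker_metric a b c x 2 4 = 1"
  "walker_metric a b c x 3 1 = 1" "walker_metric a b c x 3 2 = 0"
  "walker_metric a b c x 3 3 = a x" "walker_metric a b c x 3 4 = c x"
  "walker_metric a b c x 4 1 = 0" "walker_metric a b c x 4 2 = 1"
  "walker_metric a b c x 4 3 = c x" "walker_metric a b c x 4 4 = b x"
  by (simp_all add: walker_metric_def)

lemma kronecker_4 [simp]: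
  "kronecker (1::4) 1 = 1" "kronecker (1::4) 2 = 0" "kronecker (1::4) 3 = 0" "kronecker (1::4) 4 = 0"
  "kronecker (2::4) 1 = 0" "kronecker (2::4) 2 = 1" "kronecker (2::4) 3 = 0" "kronecker (2::4) 4 = 0"
  "kronecker (3::4) 1 = 0" "kronecker (3::4) 2 = 0" "kronecker (3::4) 3 = 1" "kronecker (3::4) 4 = 0"
  "kronecker (4::4) 1 = 0" "kronecker (4::4) 2 = 0" "kronecker (4::4) 3 = 0" "kronecker (4::4) 4 = 1"
  by (simp_all add: kronecker_def)

definition walker_inv :: "real \<Rightarrow> real \<Rightarrow> real \<Rightarrow> 4 \<Rightarrow> 4 \<Rightarrow> real" where
  "walker_inv a b c i j =
     (if (i = 1 \<and> j = 3) \<or> (i = 3 \<and> j = 1) \<or> (i = 2 \<and> j = 4) \<or> (i = 4 \<and> j = 2) then 1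
      else if i = 1 \<and> j = 1 then - a
      else if i = 2 \<and> j = 2 then - b
      else if (i = 1 \<and> j = 2) \<or> (i = 2 \<and> j = 1) then - c
      else 0)"

lemma walker_inv_simps [simp]:
  "walker_inv a b c 1 1 = - a" "walker_inv a b c 1 2 = - c"
  "walker_inv a b c 1 3 = 1" "walker_inv a b c 1 4 = 0"
  "walker_inv a b c 2 1 = - c" "walker_inv a b c 2 2 = - b"
  "walker_inv a b c 2 3 = 0" "walker_inv a b c 2 4 = 1"
  "walker_inv a b c 3 1 = 1" "walker_inv a b c 3 2 = 0"
  "walker_inv a b c 3 3 = 0" "walker_inv a b c 3 4 = 0"
  "walker_inv a b c 4 1 = 0" "walker_inv a b c 4 2 = 1"
  "walker_inv a b c 4 3 = 0" "walker_inv a b c 4 4 = 0"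
  by (simp_all add: walker_inv_def)

lemma walker_metric_inverse:
  "metric_matrix (walker_metric a b c) x ** (\<chi> i j. walker_inv (a x) (b x) (c x) i j) = mat 1"
  by (simp add: vec_eq_iff forall_4 matrix_matrix_mult_def sum_4 metric_matrix_def mat_def)

lemma inv_metric_walker: "inv_metric (walker_metric a b c) x i j = walker_inv (a x) (b x) (c x) i j"
  by (simp add: inv_metric_def matrix_inv_eqI[OF walker_metric_inverse])

lemma walker_metric_sym: "walker_metric a b c x i j = walker_metric a b c x j i"
proof -
  have "\<forall>i j. walker_metric a b c x i j = walker_metric a b c x j i"
    by (simp add: forall_4)
  then show ?thesis by blast
qed

lemma det_walker_metric: "det (metric_matrix (walker_metric a b c) x) \<noteq> 0"
  unfolding invertible_det_nz[symmetric] invertible_right_inverse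
  by (rule exI[of _ "\<chi> i j. walker_inv (a x) (b x) (c x) i j"]) (rule walker_metric_inverse)

locale walker =
  fixes U :: "(real^4) set" and a b c :: "real^4 \<Rightarrow> real"
  assumes open_dom: "open U"
    and smooth: "smooth_on U a" "smooth_on U b" "smooth_on U c"
    and indep: "x \<in> U \<Longrightarrow> k \<in> {3, 4} \<Longrightarrow> partial k a x = 0"
      "x \<in> U \<Longrightarrow> k \<in> {3, 4} \<Longrightarrow> partial k b x = 0"
      "x \<in> U \<Longrightarrow> k \<in> {3, 4} \<Longrightarrow> partial k c x = 0"
begin

abbreviation w :: "4 metric" where "w \<equiv> walker_metric a b c"

lemma differentiable_abc [simp]:
  assumes "x \<in> U"
  shows "a differentiable (at x)" "b differentiable (at x)" "c differentiable (at x)"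
    "partial i a differentiable (at x)" "partial i b differentiable (at x)" "partial i c differentiable (at x)"
  using smooth_on_imp_differentiable[OF _ open_dom assms] smooth smooth_on_partial by blast+

lemma partial_mixed_zero:
  assumes "x \<in> U" "k \<in> {3, 4}" "f \<in> {a, b, c}"
  shows "partial k f x = 0" "partial i (partial k f) x = 0" "partial k (partial i f) x = 0"
proof -
  show "partial k f x = 0"
    using assms indep by auto
  have "partial i (partial k f) x = partial i (\<lambda>_. 0) x"
    by (rule partial_cong_open[OF open_dom assms(1)]) (use assms indep in auto)
  then show "partial i (partial k f) x = 0"
    by simp
  then show "partial k (partial i f) x = 0"
    using smooth_on_partial_commute[OF _ open_dom assms(1), of f] smooth assms(3) by auto
qed

lemma partial_abc_simps [simp]:
  assumes "x \<in> U"
  shows "partial 3 a x = 0" "partial 4 a x = 0" "partial 3 b x = 0" "partial 4 b x = 0"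
    "partial 3 c x = 0" "partial 4 c x = 0"
    "partial i (partial 3 a) x = 0" "partial i (partial 4 a) x = 0" "partial i (partial 3 b) x = 0"
    "partial i (partial 4 b) x = 0" "partial i (partial 3 c) x = 0" "partial i (partial 4 c) x = 0"
    "partial 3 (partial i a) x = 0" "partial 4 (partial i a) x = 0" "partial 3 (partial i b) x = 0"
    "partial 4 (partial i b) x = 0" "partial 3 (partial i c) x = 0" "partial 4 (partial i c) x = 0"
    "partial 2 (partial 1 a) x = partial 1 (partial 2 a) x"
    "partial 2 (partial 1 b) x = partial 1 (partial 2 b) x"
    "partial 2 (partial 1 c) x = partial 1 (partial 2 c) x"
  using assms smooth_on_partial_commute[OF _ open_dom assms(1)] smooth
  by (simp_all add: partial_mixed_zero)

lemma differentiable_w: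
  assumes "x \<in> U"
  shows "(\<lambda>y. w y i j) differentiable (at x)" "partial k (\<lambda>y. w y i j) differentiable (at x)"
proof -
  have "\<forall>i j. (\<lambda>y. w y i j) differentiable (at x) \<and> partial k (\<lambda>y. w y i j) differentiable (at x)"
    using assms by (simp add: forall_4 partial_const[abs_def])
  then show "(\<lambda>y. w y i j) differentiable (at x)" "partial k (\<lambda>y. w y i j) differentiable (at x)"
    by auto
qed

lemma partial_w_zero:
  assumes "x \<in> U" "k \<in> {3, 4}"
  shows "partial k (\<lambda>y. w y i j) x = 0"
proof -
  have "\<forall>i j. partial k (\<lambda>y. w y i j) x = 0"
    using assms indep by (simp add: forall_4)
  then show ?thesis by auto
qed

lemma partial_w_const [simp]:
  "partial k (\<lambda>y. w y 1 i) x = 0" "partial k (\<lambda>y. w y 2 i) x = 0"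
  "partial k (\<lambda>y. w y i 1) x = 0" "partial k (\<lambda>y. w y i 2) x = 0"
proof -
  have "\<forall>i. partial k (\<lambda>y. w y 1 i) x = 0 \<and> partial k (\<lambda>y. w y 2 i) x = 0 \<and>
     partial k (\<lambda>y. w y i 1) x = 0 \<and> partial k (\<lambda>y. w y i 2) x = 0"
    by (simp add: forall_4)
  then show "partial k (\<lambda>y. w y 1 i) x = 0" "partial k (\<lambda>y. w y 2 i) x = 0"
    "partial k (\<lambda>y. w y i 1) x = 0" "partial k (\<lambda>y. w y i 2) x = 0" by auto
qed

lemma christoffel_w:
  assumes "x \<in> U"
  shows "christoffel w 1 i j x = (partial i (\<lambda>y. w y j 3) x + partial j (\<lambda>y. w y i 3) x
      + (a x * partial 1 (\<lambda>y. w y i j) x + c x * partial 2 (\<lambda>y. w y i j) x)) / 2"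
    and "christoffel w 2 i j x = (partial i (\<lambda>y. w y j 4) x + partial j (\<lambda>y. w y i 4) x
      + (c x * partial 1 (\<lambda>y. w y i j) x + b x * partial 2 (\<lambda>y. w y i j) x)) / 2"
    and "christoffel w 3 i j x = - partial 1 (\<lambda>y. w y i j) x / 2"
    and "christoffel w 4 i j x = - partial 2 (\<lambda>y. w y i j) x / 2"
  unfolding christoffel_def inv_metric_walker sum_4
  by (simp_all add: partial_w_zero assms field_simps)

lemma partial_christoffel_w:
  assumes "x \<in> U"
  shows "partial k (christoffel w 1 i j) x = (partial k (partial i (\<lambda>y. w y j 3)) x + partial k (partial j (\<lambda>y. w y i 3)) x
      + (a x * partial k (partial 1 (\<lambda>y. w y i j)) x + partial k a x * partial 1 (\<lambda>y. w y i j) x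
       + (c x * partial k (partial 2 (\<lambda>y. w y i j)) x + partial k c x * partial 2 (\<lambda>y. w y i j) x))) / 2" (is ?A1)
    and "partial k (christoffel w 2 i j) x = (partial k (partial i (\<lambda>y. w y j 4)) x + partial k (partial j (\<lambda>y. w y i 4)) x
      + (c x * partial k (partial 1 (\<lambda>y. w y i j)) x + partial k c x * partial 1 (\<lambda>y. w y i j) x
       + (b x * partial k (partial 2 (\<lambda>y. w y i j)) x + partial k b x * partial 2 (\<lambda>y. w y i j) x))) / 2" (is ?A2)
    and "partial k (christoffel w 3 i j) x = - partial k (partial 1 (\<lambda>y. w y i j)) x / 2" (is ?A3)
    and "partial k (christoffel w 4 i j) x = - partial k (partial 2 (\<lambda>y. w y i j)) x / 2" (is ?A4)
    and "christoffel w l i j differentiable (at x)" (is ?D)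
proof -
  note cong = partial_cong_open[OF open_dom assms]
  note simps = partial_add partial_mult partial_minus partial_divide_const differentiable_w assms
  show ?A1 by (subst cong[OF christoffel_w(1)], assumption) (simp add: simps)
  show ?A2 by (subst cong[OF christoffel_w(2)], assumption) (simp add: simps)
  show ?A3 by (subst cong[OF christoffel_w(3)], assumption) (simp add: simps)
  show ?A4 by (subst cong[OF christoffel_w(4)], assumption) (simp add: simps)
  note dcong = differentiable_cong_open[OF open_dom assms]
  have "\<forall>l. christoffel w l i j differentiable (at x)"
    unfolding forall_4
    by (intro conjI dcong[OF christoffel_w(1)] dcong[OF christoffel_w(2)] dcong[OF christoffel_w(3)]
        dcong[OF christoffel_w(4)]) (simp_all add: differentiable_w assms)
  then show ?D by blast
qed

sublocale metric_on U w
proof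
  fix x i j assume x: "x \<in> U"
  show "(\<lambda>x. inv_metric w x i j) differentiable (at x)"
  proof -
    have "\<forall>i j. (\<lambda>x. walker_inv (a x) (b x) (c x) i j) differentiable (at x)"
      using x by (simp add: forall_4)
    then show ?thesis by (simp add: inv_metric_walker)
  qed
qed (use open_dom differentiable_w partial_christoffel_w(5) det_walker_metric walker_metric_sym in auto)

text \<open>The components \<open>R(\<partial>\<^sub>i, \<partial>\<^sub>j, \<partial>\<^sub>k, \<partial>\<^sub>m)\<close> with \<open>(i, j)\<close> and \<open>(k, m)\<close> among the pairs 13, 14, 23, 24, 34;
  the components involving the pair 12 vanish.\<close>

definition basic_curvature :: "4 \<Rightarrow> 4 \<Rightarrow> 4 \<Rightarrow> 4 \<Rightarrow> real^4 \<Rightarrow> real" where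
  "basic_curvature i j k m x = (
     let a1 = partial 1 a x; a2 = partial 2 a x; b1 = partial 1 b x; b2 = partial 2 b x;
       c1 = partial 1 c x; c2 = partial 2 c x;
       a11 = partial 1 (partial 1 a) x; a12 = partial 1 (partial 2 a) x; a22 = partial 2 (partial 2 a) x;
       b11 = partial 1 (partial 1 b) x; b12 = partial 1 (partial 2 b) x; b22 = partial 2 (partial 2 b) x;
       c11 = partial 1 (partial 1 c) x; c12 = partial 1 (partial 2 c) x; c22 = partial 2 (partial 2 c) x;
       r13 = (a2 * b1 - c1 * c2) / 4; r14 = (b1 * c2 - a1 * b1 - b2 * c1 + c1 * c1) / 4;
       r23 = (a1 * c2 + a2 * b2 - a2 * c1 - c2 * c2) / 4; r24 = (c1 * c2 - a2 * b1) / 4;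
       r34 = (a x * (c1 * c1 - a1 * b1) + b x * (c2 * c2 - a2 * b2) + c x * (2 * c1 * c2 - a1 * b2 - a2 * b1)) / 4
     in if i = 1 \<and> j = 3 then
       (if k = 1 \<and> m = 3 then a11 / 2 else if k = 1 \<and> m = 4 then c11 / 2 else if k = 2 \<and> m = 3 then a12 / 2
        else if k = 2 \<and> m = 4 then c12 / 2 else if k = 3 \<and> m = 4 then r13 else 0)
     else if i = 1 \<and> j = 4 then
       (if k = 1 \<and> m = 3 then c11 / 2 else if k = 1 \<and> m = 4 then b11 / 2 else if k = 2 \<and> m = 3 then c12 / 2
        else if k = 2 \<and> m = 4 then b12 / 2 else if k = 3 \<and> m = 4 then r14 else 0)
     else if i = 2 \<and> j = 3 then
       (if k = 1 \<and> m = 3 then a12 / 2 else if k = 1 \<and> m = 4 then c12 / 2 else if k = 2 \<and> m = 3 then a22 / 2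
        else if k = 2 \<and> m = 4 then c22 / 2 else if k = 3 \<and> m = 4 then r23 else 0)
     else if i = 2 \<and> j = 4 then
       (if k = 1 \<and> m = 3 then c12 / 2 else if k = 1 \<and> m = 4 then b12 / 2 else if k = 2 \<and> m = 3 then c22 / 2
        else if k = 2 \<and> m = 4 then b22 / 2 else if k = 3 \<and> m = 4 then r24 else 0)
     else if i = 3 \<and> j = 4 then
       (if k = 1 \<and> m = 3 then r13 else if k = 1 \<and> m = 4 then r14 else if k = 2 \<and> m = 3 then r23
        else if k = 2 \<and> m = 4 then r24 else if k = 3 \<and> m = 4 then r34 else 0)
     else 0)"

text \<open>The table is supported on increasing index pairs; skew symmetry in each pair extends it,
  so at most one of the four terms is nonzero.\<close>

definition curvature :: "4 \<Rightarrow> 4 \<Rightarrow> 4 \<Rightarrow> 4 \<Rightarrow> real^4 \<Rightarrow> real" where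
  "curvature i j k m x = basic_curvature i j k m x - basic_curvature j i k m x
     - basic_curvature i j m k x + basic_curvature j i m k x"

lemma lower_riemann_w:
  assumes "x \<in> U"
  shows "(\<Sum>l\<in>UNIV. w x m l * riemann w l i j k x) = curvature i j k m x"
proof -
  \<comment> \<open>Skew symmetry in the first pair reduces the 256 components to six pairs
    \<open>i\<close>, \<open>j\<close>, each treated for all \<open>k\<close>, \<open>m\<close> at
    once.\<close>
  define P where "P i j \<longleftrightarrow> (\<forall>k m. (\<Sum>l\<in>UNIV. w x m l * riemann w l i j k x) = curvature i j k m x)" for i j
  have swap: "P j i" if "P i j" for i j
    unfolding P_def
  proof (intro allI)
    fix k m
    have "(\<Sum>l\<in>UNIV. w x m l * riemann w l j i k x) = - (\<Sum>l\<in>UNIV. w x m l * riemann w l i j k x)"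
      by (simp add: riemann_def sum_negf[symmetric] algebra_simps sum_subtractf sum.distrib)
    then show "(\<Sum>l\<in>UNIV. w x m l * riemann w l j i k x) = curvature j i k m x"
      using that by (simp add: P_def curvature_def)
  qed
  have diag: "P i i" for i
    by (simp add: P_def riemann_def curvature_def)
  note simps = P_def forall_4 sum_4 riemann_def christoffel_w partial_christoffel_w curvature_def basic_curvature_def
    partial_const[abs_def] assms
  have "P 1 2" by (simp add: simps)
  moreover have "P 1 3" by ((simp add: simps Let_def); (simp add: field_simps)?)
  moreover have "P 1 4" by ((simp add: simps Let_def); (simp add: field_simps)?)
  moreover have "P 2 3" by ((simp add: simps Let_def); (simp add: field_simps)?)
  moreover have "P 2 4" by ((simp add: simps Let_def); (simp add: field_simps)?)
  moreover have "P 3 4" by ((simp add: simps Let_def); (simp add: field_simps)?)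
  ultimately have "\<forall>i j. P i j"
    using swap diag by (simp only: forall_4)
  then show ?thesis by (simp add: P_def)
qed

text \<open>Flatness forces these values on the components 33, 34 and 44 of the conformal Hessian.\<close>

definition hess33 :: "real^4 \<Rightarrow> real" where
  "hess33 x = (partial 1 a x * partial 2 c x + partial 2 a x * partial 2 b x - partial 2 a x * partial 1 c x
     - partial 2 c x * partial 2 c x) / 4 + c x * partial 1 (partial 2 a) x / 2 + a x * partial 1 (partial 1 a) x / 4"

definition hess34 :: "real^4 \<Rightarrow> real" where
  "hess34 x = (partial 1 c x * partial 2 c x - partial 2 a x * partial 1 b x) / 4
     - c x * partial 1 (partial 1 a) x / 4 + a x * partial 1 (partial 2 b) x / 2"

definition hess44 :: "real^4 \<Rightarrow> real" where
  "hess44 x = (partial 1 a x * partial 1 b x + partial 2 b x * partial 1 c x - partial 1 b x * partial 2 c x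
     - partial 1 c x * partial 1 c x) / 4 - b x * partial 1 (partial 1 a) x / 4 + c x * partial 1 (partial 2 b) x / 2"

text \<open>These are the equations expressing that the Weyl tensor vanishes.\<close>

definition weyl_flat_at :: "real^4 \<Rightarrow> bool" where
  "weyl_flat_at x \<longleftrightarrow>
     partial 2 (partial 2 a) x = 0 \<and> partial 1 (partial 1 b) x = 0 \<and> partial 1 (partial 2 c) x = 0 \<and>
     partial 2 (partial 2 b) x = - partial 1 (partial 1 a) x \<and>
     partial 1 (partial 1 c) x = partial 1 (partial 2 b) x \<and>
     partial 2 (partial 2 c) x = partial 1 (partial 2 a) x \<and>
     b x * partial 1 (partial 2 a) x - a x * partial 1 (partial 2 b) x + c x * partial 1 (partial 1 a) x = 0 \<and>
     (a x * (partial 1 c x * partial 1 c x - partial 1 a x * partial 1 b x)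
      + b x * (partial 2 c x * partial 2 c x - partial 2 a x * partial 2 b x)
      + c x * (2 * partial 1 c x * partial 2 c x - partial 1 a x * partial 2 b x - partial 2 a x * partial 1 b x)) / 4
     + b x * hess33 x - 2 * c x * hess34 x + a x * hess44 x = 0"

text \<open>Modulo the linear equation just before it, the last equation becomes, up to a constant
  factor, the determinant of (a, b, c) and its two first partial derivatives; the difference is that
  linear equation times \<open>c x / 2\<close>.\<close>

lemma weyl_flat_at_iff:
  "weyl_flat_at x \<longleftrightarrow>
     partial 2 (partial 2 a) x = 0 \<and> partial 1 (partial 1 b) x = 0 \<and> partial 1 (partial 2 c) x = 0 \<and>
     partial 2 (partial 2 b) x = - partial 1 (partial 1 a) x \<and>
     partial 1 (partial 1 c) x = partial 1 (partial 2 b) x \<and>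
     partial 2 (partial 2 c) x = partial 1 (partial 2 a) x \<and>
     b x * partial 1 (partial 2 a) x - a x * partial 1 (partial 2 b) x + c x * partial 1 (partial 1 a) x = 0 \<and>
     a x * (partial 2 b x * partial 1 c x - partial 1 b x * partial 2 c x)
      + b x * (partial 1 a x * partial 2 c x - partial 2 a x * partial 1 c x)
      + c x * (partial 2 a x * partial 1 b x - partial 1 a x * partial 2 b x) = 0"
proof -
  let ?X = "b x * partial 1 (partial 2 a) x - a x * partial 1 (partial 2 b) x + c x * partial 1 (partial 1 a) x"
  have "(a x * (partial 1 c x * partial 1 c x - partial 1 a x * partial 1 b x)
      + b x * (partial 2 c x * partial 2 c x - partial 2 a x * partial 2 b x)
      + c x * (2 * partial 1 c x * partial 2 c x - partial 1 a x * partial 2 b x - partial 2 a x * partial 1 b x)) / 4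
     + b x * hess33 x - 2 * c x * hess34 x + a x * hess44 x
    = (a x * (partial 2 b x * partial 1 c x - partial 1 b x * partial 2 c x)
      + b x * (partial 1 a x * partial 2 c x - partial 2 a x * partial 1 c x)
      + c x * (partial 2 a x * partial 1 b x - partial 1 a x * partial 2 b x)) / 4 + c x * ?X / 2"
    unfolding hess33_def hess34_def hess44_def by (simp add: field_simps)
  then show ?thesis
    unfolding weyl_flat_at_def by auto
qed

end

section \<open>Flatness of a rescaled Walker metric as pointwise algebraic equations\<close>

locale conformal_walker = walker +
  fixes \<sigma> :: "real^4 \<Rightarrow> real"
  assumes smooth_\<sigma>: "smooth_on U \<sigma>"
begin

sublocale conformal_change U w \<sigma>
  by unfold_locales (rule smooth_\<sigma>)

abbreviation hess :: "4 \<Rightarrow> 4 \<Rightarrow> real^4 \<Rightarrow> real" where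
  "hess \<equiv> conformal_hessian w \<sigma>"

lemma hess_sym:
  assumes "x \<in> U"
  shows "hess i j x = hess j i x"
  unfolding conformal_hessian_def
  using christoffel_sym[OF assms, of _ i j] metric_sym[OF assms, of i j]
    smooth_on_partial_commute[OF smooth_\<sigma> open_dom assms, of i j] by simp

lemma lower_riemann_conf:
  assumes "x \<in> U"
  shows "(\<Sum>l\<in>UNIV. w x m l * riemann conf l i j k x) = curvature i j k m x
    + w x m j * hess i k x - w x m i * hess j k x + w x i k * hess j m x - w x j k * hess i m x"
proof -
  have "(\<Sum>l\<in>UNIV. w x m l * riemann conf l i j k x) = (\<Sum>l\<in>UNIV. w x m l * riemann w l i j k x)
    + (\<Sum>l\<in>UNIV. w x m l * kronecker l j) * hess i k x - (\<Sum>l\<in>UNIV. w x m l * kronecker l i) * hess j k x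
    + w x i k * (\<Sum>l\<in>UNIV. w x m l * (\<Sum>n\<in>UNIV. inv_metric w x l n * hess j n x))
    - w x j k * (\<Sum>l\<in>UNIV. w x m l * (\<Sum>n\<in>UNIV. inv_metric w x l n * hess i n x))"
    unfolding riemann_conf[OF assms]
    by (simp only: distrib_left right_diff_distrib sum.distrib sum_subtractf sum_distrib_left sum_distrib_right mult_ac)
  then show ?thesis
    unfolding lower_riemann_w[OF assms] lower_raise(1)[OF assms] by simp
qed

lemma flat_at_iff:
  assumes "x \<in> U"
  shows "(\<forall>l i j k. riemann conf l i j k x = 0) \<longleftrightarrow> (\<forall>i j k m. curvature i j k m x
    + w x m j * hess i k x - w x m i * hess j k x + w x i k * hess j m x - w x j k * hess i m x = 0)"
    (is "?L \<longleftrightarrow> ?R")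
proof
  show ?R if ?L
    using that by (simp flip: lower_riemann_conf[OF assms])
  show ?L if ?R
  proof (intro allI)
    fix l i j k
    have "(\<Sum>n\<in>UNIV. w x m n * riemann conf n i j k x) = 0" for m
      unfolding lower_riemann_conf[OF assms] using that by blast
    then show "riemann conf l i j k x = 0"
      using lower_raise(2)[OF assms, of l "\<lambda>n. riemann conf n i j k x"] by simp
  qed
qed

text \<open>Where the Weyl equations hold, the right-hand sides are the components of the Schouten
  tensor of the Walker metric; this is the system that a flattening \<sigma> has to solve.\<close>

definition hess_flat_at :: "real^4 \<Rightarrow> bool" where
  "hess_flat_at x \<longleftrightarrow>
     hess 1 1 x = 0 \<and> hess 1 2 x = 0 \<and> hess 2 2 x = 0 \<and>
     hess 1 3 x = partial 1 (partial 1 a) x / 4 \<and> hess 1 4 x = partial 1 (partial 2 b) x / 2 \<and>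
     hess 2 3 x = partial 1 (partial 2 a) x / 2 \<and> hess 2 4 x = - partial 1 (partial 1 a) x / 4 \<and>
     hess 3 3 x = hess33 x \<and> hess 3 4 x = hess34 x \<and> hess 4 4 x = hess44 x"

lemma flat_at_imp:
  assumes "x \<in> U" "\<forall>l i j k. riemann conf l i j k x = 0"
  shows "weyl_flat_at x"
proof -
  note * = assms(2)[unfolded flat_at_iff[OF assms(1)], rule_format]
  \<comment> \<open>The components with first pair 12, where the curvature vanishes, give
    \<open>hess\<close> 11 = 12 = 22 = 0 and 24 = - 13. The pairs among 13, 14, 23, 24 then express
    the second derivatives of \<open>a\<close>, \<open>b\<close>, \<open>c\<close> by the remaining
    mixed entries, and those with second pair 34 determine the entries 33, 34, 44. The last one,
    3434, is the final Weyl equation.\<close>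
  note eqs = *[of 1 2 1 4] *[of 1 2 1 3] *[of 1 2 2 3] *[of 1 3 1 3] *[of 1 3 1 4] *[of 1 3 2 3] *[of 1 3 2 4]
    *[of 1 4 1 4] *[of 2 3 2 3] *[of 2 3 2 4] *[of 2 4 2 4] *[of 1 4 2 4] *[of 1 2 3 4] *[of 1 4 2 3]
    *[of 1 3 3 4] *[of 1 4 3 4] *[of 2 3 3 4] *[of 2 4 3 4] *[of 3 4 3 4]
  note sym = hess_sym[OF assms(1), of 2 1] hess_sym[OF assms(1), of 3 1] hess_sym[OF assms(1), of 4 1]
    hess_sym[OF assms(1), of 3 2] hess_sym[OF assms(1), of 4 2] hess_sym[OF assms(1), of 4 3]
  note eqs' = eqs[unfolded curvature_def basic_curvature_def Let_def, simplified, unfolded sym]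
  have jets: "partial 1 (partial 1 a) x = 4 * hess 1 3 x" "partial 1 (partial 2 a) x = 2 * hess 2 3 x"
    "partial 1 (partial 2 b) x = 2 * hess 1 4 x" "hess 2 4 x = - hess 1 3 x"
    using eqs' by auto
  have h33: "hess 3 3 x = hess33 x" and h34: "hess 3 4 x = hess34 x" and h44: "hess 4 4 x = hess44 x"
    using eqs' unfolding hess33_def hess34_def hess44_def jets by (simp_all add: jets field_simps)
  \<comment> \<open>The components 1334 and 2434 both determine \<open>hess 3 4\<close>; this
    equation says that the two values agree.\<close>
  have "b x * partial 1 (partial 2 a) x - a x * partial 1 (partial 2 b) x + c x * partial 1 (partial 1 a) x = 0"
    using eqs' unfolding jets by (simp add: jets field_simps)
  moreover have "partial 2 (partial 2 a) x = 0" "partial 1 (partial 1 b) x = 0" "partial 1 (partial 2 c) x = 0"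
     "partial 2 (partial 2 b) x = - partial 1 (partial 1 a) x"
     "partial 1 (partial 1 c) x = partial 1 (partial 2 b) x"
     "partial 2 (partial 2 c) x = partial 1 (partial 2 a) x"
    using eqs' by (simp_all add: jets)
  ultimately show ?thesis
    using eqs'(19) unfolding weyl_flat_at_def h33 h34 h44 by (simp add: algebra_simps)
qed

lemma flat_atI:
  assumes x: "x \<in> U" and weyl: "weyl_flat_at x" and hess: "hess_flat_at x"
  shows "riemann conf l i j k x = 0"
proof -
  define P where "P i j \<longleftrightarrow> (\<forall>k m. curvature i j k m x
    + w x m j * hess i k x - w x m i * hess j k x + w x i k * hess j m x - w x j k * hess i m x = 0)" for i j
  have swap: "P j i" if "P i j" for i j
    unfolding P_def
  proof (intro allI)
    fix k m
    have "curvature j i k m x = - curvature i j k m x"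
      by (simp add: curvature_def)
    then show "curvature j i k m x + w x m i * hess j k x - w x m j * hess i k x + w x j k * hess i m x
        - w x i k * hess j m x = 0"
      using that[unfolded P_def, rule_format, of k m] by linarith
  qed
  have diag: "P i i" for i
    by (simp add: P_def curvature_def)
  note sym = hess_sym[OF x, of 2 1] hess_sym[OF x, of 3 1] hess_sym[OF x, of 4 1]
    hess_sym[OF x, of 3 2] hess_sym[OF x, of 4 2] hess_sym[OF x, of 4 3]
  note simps = P_def forall_4 curvature_def basic_curvature_def Let_def sym
    weyl[unfolded weyl_flat_at_def] hess[unfolded hess_flat_at_def]
  note X = weyl[unfolded weyl_flat_at_def]
  have "P 1 2" by (simp add: simps)
  moreover have "P 1 3" by ((simp add: simps); (simp add: hess34_def field_simps))
  moreover have "P 1 4" by ((simp add: simps); (simp add: hess44_def field_simps))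
  moreover have "P 2 3" by ((simp add: simps); (simp add: hess33_def field_simps))
  moreover have "P 2 4" using X by ((simp add: simps); (simp add: hess34_def field_simps))
  moreover have "P 3 4"
    by ((simp add: simps); insert X hess33_def[of x] hess34_def[of x] hess44_def[of x]; elim conjE; intro conjI; (linarith | (simp add: field_simps)))
  ultimately have "\<forall>i j. P i j"
    using swap diag by (simp only: forall_4)
  then show ?thesis
    using flat_at_iff[OF x] unfolding P_def by blast
qed

end

section \<open>Commuting linear flows\<close>

text \<open>The exponential series of \<open>t\<close> times \<open>A\<close>, taken entry by entry.
  The third property holds termwise, since a matrix commuting with \<open>A\<close> commutes with
  its powers; it is what makes two flows compatible.\<close>

lemma matrix_exponential:
  fixes A :: "real^'n^'n"
  obtains \<Phi> :: "real \<Rightarrow> real^'n^'n" where "\<Phi> 0 = mat 1"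
    and "\<And>t i j. ((\<lambda>t. \<Phi> t $ i $ j) has_real_derivative (A ** \<Phi> t) $ i $ j) (at t)"
    and "\<And>B t. A ** B = B ** A \<Longrightarrow> \<Phi> t ** B = B ** \<Phi> t"
proof -
  define P where "P n = ((\<lambda>X. A ** X) ^^ n) (mat 1)" for n
  have P: "P 0 = mat 1" "P (Suc n) = A ** P n" for n
    by (simp_all add: P_def)
  \<comment> \<open>The sum of all absolute entries dominates every row sum, hence bounds each entry
    of the n-th power of \<open>A\<close> by \<open>C ^ n\<close>, and the exponential series of
    \<open>C * \<bar>y\<bar>\<close> is a majorant.\<close>
  define C where "C = (\<Sum>i\<in>UNIV. \<Sum>j\<in>UNIV. \<bar>A $ i $ j\<bar>)"
  have row: "(\<Sum>j\<in>UNIV. \<bar>A $ i $ j\<bar>) \<le> C" for i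
    unfolding C_def by (rule member_le_sum) (auto intro: sum_nonneg)
  have "C \<ge> 0"
    unfolding C_def by (intro sum_nonneg) auto
  have bound: "\<bar>P n $ i $ j\<bar> \<le> C ^ n" for n i j
  proof (induction n arbitrary: i)
    case 0
    then show ?case by (simp add: P mat_def)
  next
    case (Suc n)
    have "\<bar>P (Suc n) $ i $ j\<bar> \<le> (\<Sum>k\<in>UNIV. \<bar>A $ i $ k\<bar> * \<bar>P n $ k $ j\<bar>)"
      by (simp add: P matrix_matrix_mult_def abs_mult[symmetric] sum_abs)
    also have "\<dots> \<le> (\<Sum>k\<in>UNIV. \<bar>A $ i $ k\<bar> * C ^ n)"
      by (intro sum_mono mult_left_mono Suc.IH) auto
    also have "\<dots> \<le> C * C ^ n"
      unfolding sum_distrib_right[symmetric] using row \<open>C \<ge> 0\<close> by (intro mult_right_mono) auto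
    finally show ?case by simp
  qed
  have summ: "summable (\<lambda>n. P n $ i $ j / fact n * y ^ n)" for i j and y :: real
  proof (rule summable_comparison_test')
    show "summable (\<lambda>n. (C * \<bar>y\<bar>) ^ n / fact n)"
      using summable_exp[of "C * \<bar>y\<bar>"] by (simp add: divide_inverse mult.commute)
    show "norm (P n $ i $ j / fact n * y ^ n) \<le> (C * \<bar>y\<bar>) ^ n / fact n" for n
      using mult_right_mono[OF bound[of n i j], of "\<bar>y\<bar> ^ n"]
      by (simp add: abs_mult power_abs power_mult_distrib divide_right_mono)
  qed
  define \<Phi> where "\<Phi> t = (\<chi> i j. \<Sum>n. P n $ i $ j / fact n * t ^ n)" for t
  have 1: "\<Phi> 0 = mat 1"
    by (simp add: \<Phi>_def vec_eq_iff powser_zero P del: times_divide_eq_left)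
  have 2: "((\<lambda>t. \<Phi> t $ i $ j) has_real_derivative (A ** \<Phi> t) $ i $ j) (at t)" for t i j
  proof -
    have "(\<Sum>n. diffs (\<lambda>n. P n $ i $ j / fact n) n * t ^ n)
        = (\<Sum>n. \<Sum>k\<in>UNIV. A $ i $ k * (P n $ k $ j / fact n * t ^ n))"
    proof (intro suminf_cong)
      fix n
      have "diffs (\<lambda>n. P n $ i $ j / fact n) n = P (Suc n) $ i $ j / fact n"
        by (simp add: diffs_def field_simps del: of_nat_Suc)
      also have "\<dots> = (\<Sum>k\<in>UNIV. A $ i $ k * P n $ k $ j) / fact n"
        by (simp add: P matrix_matrix_mult_def)
      finally show "diffs (\<lambda>n. P n $ i $ j / fact n) n * t ^ n
          = (\<Sum>k\<in>UNIV. A $ i $ k * (P n $ k $ j / fact n * t ^ n))"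
        by (simp add: sum_divide_distrib sum_distrib_left sum_distrib_right mult_ac)
    qed
    also have "\<dots> = (A ** \<Phi> t) $ i $ j"
      by (simp add: suminf_sum[OF summable_mult[OF summ]] suminf_mult[OF summ] matrix_matrix_mult_def \<Phi>_def
          del: times_divide_eq_left times_divide_eq_right)
    finally show ?thesis
      using termdiffs_strong_converges_everywhere[of "\<lambda>n. P n $ i $ j / fact n" t] summ
      by (simp add: \<Phi>_def)
  qed
  have 3: "\<Phi> t ** B = B ** \<Phi> t" if AB: "A ** B = B ** A" for B t
  proof -
    have "P n ** B = B ** P n" for n
    proof (induction n)
      case (Suc n)
      have "P (Suc n) ** B = A ** (P n ** B)"
        by (simp add: P matrix_mul_assoc)
      also have "\<dots> = (A ** B) ** P n"
        by (simp add: Suc matrix_mul_assoc)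
      finally show ?case
        by (simp add: P AB matrix_mul_assoc)
    qed (simp add: P)
    then have comm: "(\<Sum>k\<in>UNIV. P n $ i $ k * B $ k $ j) = (\<Sum>k\<in>UNIV. B $ i $ k * P n $ k $ j)" for n i j
      by (simp add: matrix_matrix_mult_def vec_eq_iff)
    have "(\<Phi> t ** B) $ i $ j = (B ** \<Phi> t) $ i $ j" for i j
    proof -
      have "(\<Phi> t ** B) $ i $ j = (\<Sum>n. \<Sum>k\<in>UNIV. P n $ i $ k / fact n * t ^ n * B $ k $ j)"
        by (simp add: suminf_sum[OF summable_mult2[OF summ]] suminf_mult2[OF summ] matrix_matrix_mult_def \<Phi>_def
            del: times_divide_eq_left times_divide_eq_right)
      also have "\<dots> = (\<Sum>n. \<Sum>k\<in>UNIV. B $ i $ k * (P n $ k $ j / fact n * t ^ n))"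
      proof (intro suminf_cong)
        fix n
        have "(\<Sum>k\<in>UNIV. P n $ i $ k / fact n * t ^ n * B $ k $ j)
            = t ^ n / fact n * (\<Sum>k\<in>UNIV. P n $ i $ k * B $ k $ j)"
          by (simp add: sum_distrib_left mult_ac)
        also have "\<dots> = t ^ n / fact n * (\<Sum>k\<in>UNIV. B $ i $ k * P n $ k $ j)"
          by (simp only: comm)
        also have "\<dots> = (\<Sum>k\<in>UNIV. B $ i $ k * (P n $ k $ j / fact n * t ^ n))"
          by (simp add: sum_distrib_left mult_ac)
        finally show "(\<Sum>k\<in>UNIV. P n $ i $ k / fact n * t ^ n * B $ k $ j)
            = (\<Sum>k\<in>UNIV. B $ i $ k * (P n $ k $ j / fact n * t ^ n))" .
      qed
      also have "\<dots> = (B ** \<Phi> t) $ i $ j"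
        by (simp add: suminf_sum[OF summable_mult[OF summ]] suminf_mult[OF summ] matrix_matrix_mult_def \<Phi>_def
            del: times_divide_eq_left times_divide_eq_right)
      finally show ?thesis .
    qed
    then show ?thesis by (simp add: vec_eq_iff)
  qed
  show ?thesis
    using that 1 2 3 by blast
qed

text \<open>The solution is the product of the two exponentials applied to \<open>v\<close>, with
  times measured from \<open>p\<close>. Differentiating the second factor puts \<open>B\<close>
  between the exponentials; commutation moves it to the front.\<close>

lemma commuting_linear_flow:
  fixes A B :: "real^'n^'n" and v :: "real^'n" and p :: "real^'m" and r s :: 'm
  assumes AB: "A ** B = B ** A" and "r \<noteq> s"
  obtains F :: "real^'m \<Rightarrow> real^'n" where "F p = v"
    and "\<And>u i. (\<lambda>u. F u $ i) differentiable (at u)"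
    and "\<And>u i k. partial k (\<lambda>u. F u $ i) u =
      (if k = r then (A *v F u) $ i else if k = s then (B *v F u) $ i else 0)"
proof -
  obtain \<Phi> where \<Phi>: "\<Phi> 0 = mat 1"
    "\<And>t i j. ((\<lambda>t. \<Phi> t $ i $ j) has_real_derivative (A ** \<Phi> t) $ i $ j) (at t)"
    "\<And>B t. A ** B = B ** A \<Longrightarrow> \<Phi> t ** B = B ** \<Phi> t"
    by (rule matrix_exponential[of A]) blast
  obtain \<Psi> where \<Psi>: "\<Psi> 0 = mat 1"
    "\<And>t i j. ((\<lambda>t. \<Psi> t $ i $ j) has_real_derivative (B ** \<Psi> t) $ i $ j) (at t)"
    by (rule matrix_exponential[of B]) blast
  let ?x = "\<lambda>u. u $ r - p $ r" and ?y = "\<lambda>u. u $ s - p $ s"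
  define F where "F u = (\<Phi> (?x u) ** \<Psi> (?y u)) *v v" for u
  have comp: "(\<lambda>u. F u $ i) = (\<lambda>u. \<Sum>j\<in>UNIV. (\<Sum>k\<in>UNIV. \<Phi> (?x u) $ i $ k * \<Psi> (?y u) $ k $ j) * v $ j)" for i
    by (simp add: F_def matrix_vector_mult_def matrix_matrix_mult_def)
  have d\<Phi>: "(\<lambda>u. \<Phi> (?x u) $ i $ j) differentiable (at u)"
    "partial k (\<lambda>u. \<Phi> (?x u) $ i $ j) u = (if k = r then (A ** \<Phi> (?x u)) $ i $ j else 0)" for u i j k
    using differentiable_compose_real[OF \<Phi>(2), of ?x u] partial_compose[OF \<Phi>(2), of ?x u]
    by (simp_all add: partial_diff)
  have d\<Psi>: "(\<lambda>u. \<Psi> (?y u) $ i $ j) differentiable (at u)"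
    "partial k (\<lambda>u. \<Psi> (?y u) $ i $ j) u = (if k = s then (B ** \<Psi> (?y u)) $ i $ j else 0)" for u i j k
    using differentiable_compose_real[OF \<Psi>(2), of ?y u] partial_compose[OF \<Psi>(2), of ?y u]
    by (simp_all add: partial_diff)
  have inner: "(\<lambda>u. \<Sum>k\<in>UNIV. \<Phi> (?x u) $ i $ k * \<Psi> (?y u) $ k $ j) differentiable (at u)" for i j u
    by (rule differentiable_sum) (simp_all add: d\<Phi> d\<Psi>)
  have "F p = v"
    by (simp add: F_def \<Phi> \<Psi>)
  moreover have "(\<lambda>u. F u $ i) differentiable (at u)" for u i
    unfolding comp by (rule differentiable_sum) (simp_all add: inner)
  moreover have "partial k (\<lambda>u. F u $ i) u =
      (if k = r then (A *v F u) $ i else if k = s then (B *v F u) $ i else 0)" for u i k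
  proof -
    have "partial k (\<lambda>u. F u $ i) u = (\<Sum>j\<in>UNIV. (\<Sum>m\<in>UNIV.
        \<Phi> (?x u) $ i $ m * (if k = s then (B ** \<Psi> (?y u)) $ m $ j else 0)
        + (if k = r then (A ** \<Phi> (?x u)) $ i $ m else 0) * \<Psi> (?y u) $ m $ j) * v $ j)"
      unfolding comp by (simp add: partial_sum partial_mult d\<Phi> d\<Psi> inner)
    also have "\<dots> = (if k = r then ((A ** \<Phi> (?x u) ** \<Psi> (?y u)) *v v) $ i
        else if k = s then ((\<Phi> (?x u) ** (B ** \<Psi> (?y u))) *v v) $ i else 0)"
      using \<open>r \<noteq> s\<close> by (auto simp: matrix_vector_mult_def matrix_matrix_mult_def)
    also have "\<Phi> (?x u) ** (B ** \<Psi> (?y u)) = B ** (\<Phi> (?x u) ** \<Psi> (?y u))"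
      by (simp add: matrix_mul_assoc \<Phi>(3)[OF AB])
    finally show ?thesis
      by (simp add: F_def matrix_vector_mul_assoc matrix_mul_assoc)
  qed
  ultimately show ?thesis
    using that by blast
qed

section \<open>A conformal factor that flattens the metric\<close>

lemma vector_4 [simp]:
  "(vector [w, x, y, z] :: 'a::zero^4) $ 1 = w" "(vector [w, x, y, z] :: 'a^4) $ 2 = x"
  "(vector [w, x, y, z] :: 'a^4) $ 3 = y" "(vector [w, x, y, z] :: 'a^4) $ 4 = z"
  unfolding vector_def by simp_all

text \<open>\<open>S\<close> stands for the sum Q + H. With n = (- M, E, I), the first three
  conditions say that n is orthogonal to the coefficient vectors (J, N, P), (F, L, G), (K, R, S) of
  \<open>u $ 1\<close>, \<open>u $ 2\<close> and 1 in (a, b, c); the fourth says that these three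
  vectors are linearly dependent.\<close>

locale flat_constants =
  fixes E F G I J K L M N P R S :: real
  assumes C1: "0 = E * N - J * M + I * P"
    and C2: "0 = E * L - F * M + I * G"
    and C3: "0 = E * R - K * M + I * S"
    and C4: "0 = K * (L * P - N * G) + R * (J * G - F * P) + S * (F * N - J * L)"
begin

text \<open>The local twistors of a conformally flat metric of this form depend on \<open>u\<^sub>3, u\<^sub>4\<close> only, up to a
  quadratic correction, and are parallel for a flat connection with these constant coefficients.\<close>

definition twistor3 :: "real^4^4" where
  "twistor3 = vector
    [vector [(J - G) / 4, P / 2, - I / 4, (P * G - N * F + M * K) / 4 - I * S / 8],
     vector [F / 2, (G - J) / 4, - E / 2, (F * (P - L) + G * (G - J) - E * S) / 4 - I * K / 8],
     vector [K / 2, S / 2, - (J + G) / 4, (K * P + S * G - S * J - R * F) / 4],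
     vector [0, 1, 0, (J + G) / 4]]"

definition twistor4 :: "real^4^4" where
  "twistor4 = vector
    [vector [(P - L) / 4, N / 2, - M / 2, (N * (J - G) + P * (L - P) + M * S) / 4 - I * R / 8],
     vector [G / 2, (L - P) / 4, I / 4, (N * F - P * G - M * K) / 4 + I * S / 8],
     vector [S / 2, R / 2, - (P + L) / 4, (K * N + S * L - S * P - R * G) / 4],
     vector [- 1, 0, 0, (P + L) / 4]]"

text \<open>The commutator is the curvature of the twistor connection. Its entries 13, 23 and 33 are
  multiples of the first three conditions, 34 contributes the cubic one modulo the third, and the
  other entries are combinations of the first three or vanish identically.\<close>

lemma twistor_commute: "twistor3 ** twistor4 = twistor4 ** twistor3"
proof -
  have "(twistor3 ** twistor4) $ 1 $ 3 - (twistor4 ** twistor3) $ 1 $ 3 = (E * N - J * M + I * P) / 4"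
    "(twistor3 ** twistor4) $ 2 $ 2 - (twistor4 ** twistor3) $ 2 $ 2 = - (E * R - K * M + I * S) / 4"
    "(twistor3 ** twistor4) $ 2 $ 3 - (twistor4 ** twistor3) $ 2 $ 3 = (E * L - F * M + I * G) / 4"
    "(twistor3 ** twistor4) $ 3 $ 3 - (twistor4 ** twistor3) $ 3 $ 3 = (E * R - K * M + I * S) / 4"
    "(twistor3 ** twistor4) $ 1 $ 4 - (twistor4 ** twistor3) $ 1 $ 4 =
      (S * (E * N - J * M + I * P) + R * (E * L - F * M + I * G) - L * (E * R - K * M + I * S)) / 8"
    "(twistor3 ** twistor4) $ 2 $ 4 - (twistor4 ** twistor3) $ 2 $ 4 =
      (G * (E * R - K * M + I * S) - K * (E * N - J * M + I * P) - S * (E * L - F * M + I * G)) / 8"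
    "(twistor3 ** twistor4) $ 3 $ 4 - (twistor4 ** twistor3) $ 3 $ 4 =
      (K * (L * P - N * G) + R * (J * G - F * P) + S * (F * N - J * L)) / 4 + S * (E * R - K * M + I * S) / 8"
    by (simp_all add: matrix_matrix_mult_def sum_4 twistor3_def twistor4_def field_simps)
  then have "(twistor3 ** twistor4) $ 1 $ 3 = (twistor4 ** twistor3) $ 1 $ 3"
    "(twistor3 ** twistor4) $ 2 $ 2 = (twistor4 ** twistor3) $ 2 $ 2"
    "(twistor3 ** twistor4) $ 2 $ 3 = (twistor4 ** twistor3) $ 2 $ 3"
    "(twistor3 ** twistor4) $ 3 $ 3 = (twistor4 ** twistor3) $ 3 $ 3"
    "(twistor3 ** twistor4) $ 1 $ 4 = (twistor4 ** twistor3) $ 1 $ 4"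
    "(twistor3 ** twistor4) $ 2 $ 4 = (twistor4 ** twistor3) $ 2 $ 4"
    "(twistor3 ** twistor4) $ 3 $ 4 = (twistor4 ** twistor3) $ 3 $ 4"
    unfolding C1[symmetric] C2[symmetric] C3[symmetric] C4[symmetric] by simp_all
  moreover have "(twistor3 ** twistor4) $ 1 $ 1 = (twistor4 ** twistor3) $ 1 $ 1"
    "(twistor3 ** twistor4) $ 1 $ 2 = (twistor4 ** twistor3) $ 1 $ 2"
    "(twistor3 ** twistor4) $ 2 $ 1 = (twistor4 ** twistor3) $ 2 $ 1"
    "(twistor3 ** twistor4) $ 3 $ 1 = (twistor4 ** twistor3) $ 3 $ 1"
    "(twistor3 ** twistor4) $ 3 $ 2 = (twistor4 ** twistor3) $ 3 $ 2"
    "(twistor3 ** twistor4) $ 4 $ j = (twistor4 ** twistor3) $ 4 $ j" for j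
  proof -
    have "\<forall>j. (twistor3 ** twistor4) $ 4 $ j = (twistor4 ** twistor3) $ 4 $ j"
      by (simp add: forall_4 matrix_matrix_mult_def sum_4 twistor3_def twistor4_def field_simps)
    then show "(twistor3 ** twistor4) $ 4 $ j = (twistor4 ** twistor3) $ 4 $ j" ..
  qed (simp_all add: matrix_matrix_mult_def sum_4 twistor3_def twistor4_def field_simps)
  ultimately show ?thesis
    by (simp add: vec_eq_iff forall_4)
qed

definition wedge :: "(real^4 \<Rightarrow> real^4) \<Rightarrow> (real^4 \<Rightarrow> real^4) \<Rightarrow> 4 \<Rightarrow> 4 \<Rightarrow> real^4 \<Rightarrow> real" where
  "wedge V W i j u = V u $ i * W u $ j - V u $ j * W u $ i"

text \<open>The wedge product of two parallel twistors, moved by the induced action on bivectors.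
  Starting at the third and fourth basis vectors makes coordinate 34 equal to 1 at \<open>p\<close>
  and the other independent coordinates 0, so that \<phi> will be 1 there.\<close>

lemma twistor_pair:
  obtains V W :: "real^4 \<Rightarrow> real^4" where "V p = axis 3 1" "W p = axis 4 1"
    and "\<And>i j u. wedge V W i j differentiable (at u)"
    and "\<And>i j k u. partial k (wedge V W i j) u =
      (if k = 3 then (\<Sum>m\<in>UNIV. twistor3 $ i $ m * wedge V W m j u + twistor3 $ j $ m * wedge V W i m u)
       else if k = 4 then (\<Sum>m\<in>UNIV. twistor4 $ i $ m * wedge V W m j u + twistor4 $ j $ m * wedge V W i m u)
       else 0)"
proof -
  obtain V where V: "V p = axis 3 1" "\<And>u i. (\<lambda>u. V u $ i) differentiable (at u)"
    "\<And>u i k. partial k (\<lambda>u. V u $ i) u =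
      (if k = 3 then (twistor3 *v V u) $ i else if k = 4 then (twistor4 *v V u) $ i else 0)"
    by (rule commuting_linear_flow[OF twistor_commute, of "3::4" 4 p "axis 3 1"]) auto
  obtain W where W: "W p = axis 4 1" "\<And>u i. (\<lambda>u. W u $ i) differentiable (at u)"
    "\<And>u i k. partial k (\<lambda>u. W u $ i) u =
      (if k = 3 then (twistor3 *v W u) $ i else if k = 4 then (twistor4 *v W u) $ i else 0)"
    by (rule commuting_linear_flow[OF twistor_commute, of "3::4" 4 p "axis 4 1"]) auto
  have diff: "wedge V W i j differentiable (at u)" for i j u
    unfolding wedge_def[abs_def] using V(2) W(2) by (intro differentiable_diff differentiable_mult)
  have part: "partial k (wedge V W i j) u =
      (if k = 3 then (\<Sum>m\<in>UNIV. twistor3 $ i $ m * wedge V W m j u + twistor3 $ j $ m * wedge V W i m u)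
       else if k = 4 then (\<Sum>m\<in>UNIV. twistor4 $ i $ m * wedge V W m j u + twistor4 $ j $ m * wedge V W i m u)
       else 0)" for i j k u
  proof -
    have "partial k (wedge V W i j) u = V u $ i * partial k (\<lambda>u. W u $ j) u + partial k (\<lambda>u. V u $ i) u * W u $ j
       - (V u $ j * partial k (\<lambda>u. W u $ i) u + partial k (\<lambda>u. V u $ j) u * W u $ i)"
      unfolding wedge_def[abs_def] using V(2) W(2) by (simp add: partial_diff partial_mult)
    then show ?thesis
      unfolding V(3) W(3) by (simp only:) (simp add: matrix_vector_mult_def wedge_def sum_4 algebra_simps)
  qed
  show ?thesis
    by (rule that[OF V(1) W(1) diff part])
qed

end

text \<open>Here \<open>\<alpha>, \<dots>, \<tau>\<close> are the components of a simple bivector of local twistors, which is the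
  reason for the quadratic relation.\<close>

locale flat_solution = flat_constants +
  fixes \<alpha> \<beta> \<gamma> \<mu> \<nu> \<tau> :: "real^4 \<Rightarrow> real"
  assumes differentiable [simp]: "\<alpha> differentiable (at u)" "\<beta> differentiable (at u)" "\<gamma> differentiable (at u)"
      "\<mu> differentiable (at u)" "\<nu> differentiable (at u)" "\<tau> differentiable (at u)"
    and simple: "\<alpha> u * \<tau> u - \<beta> u * \<nu> u + \<gamma> u * \<mu> u = 0"
    and partial_alpha: "partial k \<alpha> u = (if k = 3 then
        (K / 2) * \<beta> u + (S / 2) * \<gamma> u + \<nu> u
      else if k = 4 then
        (S / 2) * \<beta> u + (R / 2) * \<gamma> u - \<mu> u
      else 0)"
    and partial_beta: "partial k \<beta> u = (if k = 3 then
        (- I / 4) * \<alpha> u + (J / 2) * \<beta> u + (P / 2) * \<gamma> u + \<tau> u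
      else if k = 4 then
        (- M / 2) * \<alpha> u + (P / 2) * \<beta> u + (N / 2) * \<gamma> u
      else 0)"
    and partial_gamma: "partial k \<gamma> u = (if k = 3 then
        (- E / 2) * \<alpha> u + (F / 2) * \<beta> u + (G / 2) * \<gamma> u
      else if k = 4 then
        (I / 4) * \<alpha> u + (G / 2) * \<beta> u + (L / 2) * \<gamma> u + \<tau> u
      else 0)"
    and partial_mu: "partial k \<mu> u = (if k = 3 then
        (- F * N / 4 + G * P / 4 - I * S / 8 + K * M / 4) * \<alpha> u + (F * R / 4 - G * S / 4 + J * S / 4
        - K * P / 4) * \<beta> u + (- G / 2) * \<mu> u + (P / 2) * \<nu> u + (- S / 2) * \<tau> u
      else if k = 4 then
        (- G * N / 4 - I * R / 8 + J * N / 4 + L * P / 4 + M * S / 4 - P * P / 4) * \<alpha> u + (G * R / 4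
        - K * N / 4 - L * S / 4 + P * S / 4) * \<beta> u + (- L / 2) * \<mu> u + (N / 2) * \<nu> u + (- R /
        2) * \<tau> u
      else 0)"
    and partial_nu: "partial k \<nu> u = (if k = 3 then
        (- E * S / 4 - F * L / 4 + F * P / 4 - G * J / 4 + G * G / 4 - I * K / 8) * \<alpha> u + (F * R / 4
        - G * S / 4 + J * S / 4 - K * P / 4) * \<gamma> u + (F / 2) * \<mu> u + (- J / 2) * \<nu> u + (K /
        2) * \<tau> u
      else if k = 4 then
        (F * N / 4 - G * P / 4 + I * S / 8 - K * M / 4) * \<alpha> u + (G * R / 4 - K * N / 4 - L * S / 4 +
        P * S / 4) * \<gamma> u + (G / 2) * \<mu> u + (- P / 2) * \<nu> u + (S / 2) * \<tau> u
      else 0)"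
    and partial_tau: "partial k \<tau> u = (if k = 3 then
        (- E * S / 4 - F * L / 4 + F * P / 4 - G * J / 4 + G * G / 4 - I * K / 8) * \<beta> u + (F * N / 4 -
        G * P / 4 + I * S / 8 - K * M / 4) * \<gamma> u + (E / 2) * \<mu> u + (- I / 4) * \<nu> u
      else if k = 4 then
        (F * N / 4 - G * P / 4 + I * S / 8 - K * M / 4) * \<beta> u + (G * N / 4 + I * R / 8 - J * N / 4 - L
        * P / 4 - M * S / 4 + P * P / 4) * \<gamma> u + (- I / 4) * \<mu> u + (- M / 2) * \<nu> u
      else 0)"

context flat_constants
begin

lemma wedge_sym: "wedge V W i i u = 0" "wedge V W 2 1 u = - wedge V W 1 2 u" "wedge V W 1 3 u = - wedge V W 3 1 u"
  "wedge V W 2 3 u = - wedge V W 3 2 u" "wedge V W 4 i u = - wedge V W i 4 u"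
  by (simp_all add: wedge_def)

lemma flat_solution_exists:
  obtains \<alpha> \<beta> \<gamma> \<mu> \<nu> \<tau> where "flat_solution E F G I J K L M N P R S \<alpha> \<beta> \<gamma> \<mu> \<nu> \<tau>"
    and "\<alpha> p = 1" "\<beta> p = 0" "\<gamma> p = 0"
proof -
  obtain V W :: "real^4 \<Rightarrow> real^4" where VW: "V p = axis 3 1" "W p = axis 4 1"
    "\<And>i j u. wedge V W i j differentiable (at u)"
    "\<And>i j k u. partial k (wedge V W i j) u =
      (if k = 3 then (\<Sum>m\<in>UNIV. twistor3 $ i $ m * wedge V W m j u + twistor3 $ j $ m * wedge V W i m u)
       else if k = 4 then (\<Sum>m\<in>UNIV. twistor4 $ i $ m * wedge V W m j u + twistor4 $ j $ m * wedge V W i m u)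
       else 0)"
    by (rule twistor_pair[of p]) blast
  \<comment> \<open>The index orders 31 and 32, instead of 13 and 23, give the Pluecker relation the
    signs of \<open>simple\<close>.\<close>
  have "flat_solution E F G I J K L M N P R S (wedge V W 3 4) (wedge V W 1 4) (wedge V W 2 4)
    (wedge V W 3 1) (wedge V W 3 2) (wedge V W 1 2)"
  proof
    show "wedge V W 3 4 u * wedge V W 1 2 u - wedge V W 1 4 u * wedge V W 3 2 u
        + wedge V W 2 4 u * wedge V W 3 1 u = 0" for u
      by (simp add: wedge_def algebra_simps)
  qed (simp_all add: VW(3), simp_all add: VW(4) sum_4 twistor3_def twistor4_def wedge_sym, simp_all add: field_simps)
  then show ?thesis
    by (rule that) (simp_all add: wedge_def VW(1,2) axis_def)
qed

end

text \<open>Three vectors orthogonal to a common nonzero vector are dependent. As in Cramer's rule,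
  the determinant times each coordinate of that vector is a combination of the three
  equations.\<close>

lemma det_eq_0_if_orthogonal:
  fixes E M I :: real
  assumes "E * b - M * a + I * c = 0" "E * b1 - M * a1 + I * c1 = 0" "E * b2 - M * a2 + I * c2 = 0"
    and "\<not> (E = 0 \<and> M = 0 \<and> I = 0)"
  shows "a * (b2 * c1 - b1 * c2) + b * (a1 * c2 - a2 * c1) + c * (a2 * b1 - a1 * b2) = 0" (is "?d = 0")
proof -
  have "E * ?d = 0" "M * ?d = 0" "I * ?d = 0"
    using assms(1-3) by algebra+
  with assms(4) show ?thesis
    by auto
qed

lemma generated_algebra_minus:
  "f \<in> generated_algebra H \<Longrightarrow> (\<lambda>x. - f x) \<in> generated_algebra H"
  using generated_algebra.mult[OF generated_algebra.const[of "- 1"], of f H] by simp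

lemma generated_algebra_diff:
  "f \<in> generated_algebra H \<Longrightarrow> g \<in> generated_algebra H \<Longrightarrow> (\<lambda>x. f x - g x) \<in> generated_algebra H"
  using generated_algebra.add[OF _ generated_algebra_minus, of f H g] by simp

lemma generated_algebra_if:
  "f \<in> generated_algebra H \<Longrightarrow> g \<in> generated_algebra H \<Longrightarrow> (\<lambda>x. if Q then f x else g x) \<in> generated_algebra H"
  by (cases Q) auto

lemmas generated_algebra_intros =
  generated_algebra.const generated_algebra.add generated_algebra.mult generated_algebra_minus
  generated_algebra_diff generated_algebra_if

section \<open>The conformal factor and its smoothness\<close>

context flat_solution
begin

definition \<phi> :: "real^4 \<Rightarrow> real" where
  "\<phi> u = \<alpha> u + \<beta> u * u $ 1 + \<gamma> u * u $ 2"

lemma differentiable_\<phi> [simp]: "\<phi> differentiable (at u)"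
  unfolding \<phi>_def[abs_def] by simp

lemma partial_\<phi>': "partial k \<phi> u = partial k \<alpha> u + (\<beta> u * partial k (\<lambda>u. u $ 1) u + partial k \<beta> u * u $ 1)
    + (\<gamma> u * partial k (\<lambda>u. u $ 2) u + partial k \<gamma> u * u $ 2)"
  unfolding \<phi>_def[abs_def] by (simp add: partial_add partial_mult)

lemma partial_\<phi>:
  "partial 1 \<phi> = \<beta>" "partial 2 \<phi> = \<gamma>"
  "partial 3 \<phi> = (\<lambda>u. K / 2 * \<beta> u + S / 2 * \<gamma> u + \<nu> u
     + (- I / 4 * \<alpha> u + J / 2 * \<beta> u + P / 2 * \<gamma> u + \<tau> u) * u $ 1
     + (- E / 2 * \<alpha> u + F / 2 * \<beta> u + G / 2 * \<gamma> u) * u $ 2)"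
  "partial 4 \<phi> = (\<lambda>u. S / 2 * \<beta> u + R / 2 * \<gamma> u - \<mu> u
     + (- M / 2 * \<alpha> u + P / 2 * \<beta> u + N / 2 * \<gamma> u) * u $ 1
     + (I / 4 * \<alpha> u + G / 2 * \<beta> u + L / 2 * \<gamma> u + \<tau> u) * u $ 2)"
  by (auto simp: fun_eq_iff partial_\<phi>' partial_alpha partial_beta partial_gamma)

lemma partial_\<phi>_differentiable [simp]: "partial k \<phi> differentiable (at u)"
proof -
  have "\<forall>k. partial k \<phi> differentiable (at u)"
    by (simp add: forall_4 partial_\<phi>)
  then show ?thesis ..
qed

definition \<sigma> :: "real^4 \<Rightarrow> real" where
  "\<sigma> u = - ln (\<phi> u)"

lemma
  assumes "\<phi> u > 0"
  shows differentiable_\<sigma>: "\<sigma> differentiable (at u)"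
    and differentiable_inverse_\<phi>: "(\<lambda>u. inverse (\<phi> u)) differentiable (at u)"
    and partial_\<sigma>: "partial k \<sigma> u = - partial k \<phi> u * inverse (\<phi> u)"
    and partial_inverse_\<phi>: "partial k (\<lambda>u. inverse (\<phi> u)) u = - partial k \<phi> u * (inverse (\<phi> u) * inverse (\<phi> u))"
proof -
  have 1: "((\<lambda>t. - ln t) has_real_derivative - inverse (\<phi> u)) (at (\<phi> u))"
    using assms by (auto intro!: derivative_eq_intros simp: inverse_eq_divide)
  have 2: "(inverse has_real_derivative - (inverse (\<phi> u) * inverse (\<phi> u))) (at (\<phi> u))"
    using DERIV_inverse[of "\<phi> u" UNIV] assms by (simp add: numeral_2_eq_2)
  show "\<sigma> differentiable (at u)" "(\<lambda>u. inverse (\<phi> u)) differentiable (at u)"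
    "partial k \<sigma> u = - partial k \<phi> u * inverse (\<phi> u)"
    "partial k (\<lambda>u. inverse (\<phi> u)) u = - partial k \<phi> u * (inverse (\<phi> u) * inverse (\<phi> u))"
    using differentiable_compose_real[of "\<lambda>t. - ln t" _ \<phi> u, OF 1] partial_compose[of "\<lambda>t. - ln t" _ \<phi> u, OF 1]
      differentiable_compose_real[of inverse _ \<phi> u, OF 2] partial_compose[of inverse _ \<phi> u, OF 2]
    unfolding \<sigma>_def[abs_def] by auto
qed

lemma smooth_on_\<sigma>:
  assumes "open U" "\<And>u. u \<in> U \<Longrightarrow> \<phi> u > 0"
  shows "smooth_on U \<sigma>"
proof -
  \<comment> \<open>The linear system expresses the derivatives of its six unknowns by the unknowns
    themselves with constant coefficients. Derivatives of \<phi> also bring in \<open>u $ 1\<close>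
    and \<open>u $ 2\<close>; adding \<open>inverse (\<phi> u)\<close> and \<sigma> closes the list
    under differentiation, because both derivatives are polynomial in these generators.\<close>
  define H where "H = {\<alpha>, \<beta>, \<gamma>, \<mu>, \<nu>, \<tau>, \<lambda>u. u $ 1, \<lambda>u. u $ 2, \<lambda>u. inverse (\<phi> u), \<sigma>}"
  have mem: "\<alpha> \<in> generated_algebra H" "\<beta> \<in> generated_algebra H" "\<gamma> \<in> generated_algebra H"
    "\<mu> \<in> generated_algebra H" "\<nu> \<in> generated_algebra H" "\<tau> \<in> generated_algebra H"
    "(\<lambda>u. u $ 1) \<in> generated_algebra H" "(\<lambda>u. u $ 2) \<in> generated_algebra H"
    "(\<lambda>u. inverse (\<phi> u)) \<in> generated_algebra H" "\<sigma> \<in> generated_algebra H"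
    by (auto simp: H_def intro: generated_algebra.gen)
  have mem_\<phi>: "partial k \<phi> \<in> generated_algebra H" for k
  proof -
    have "\<forall>k. partial k \<phi> \<in> generated_algebra H"
      unfolding forall_4 partial_\<phi> by (intro conjI generated_algebra_intros mem)
    then show ?thesis ..
  qed
  have closed: "\<exists>g\<in>generated_algebra H. \<forall>u\<in>U. partial k f u = g u" if "f \<in> H" for f k
  proof -
    have *: ?thesis if "f = h" "\<And>u. u \<in> U \<Longrightarrow> partial k h u = g u" "g \<in> generated_algebra H" for g h
      using that by blast
    from \<open>f \<in> H\<close> consider "f = \<alpha>" | "f = \<beta>" | "f = \<gamma>" | "f = \<mu>" | "f = \<nu>" | "f = \<tau>" | "f = (\<lambda>u. u $ 1)"
      | "f = (\<lambda>u. u $ 2)" | "f = (\<lambda>u. inverse (\<phi> u))" | "f = \<sigma>"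
      unfolding H_def by blast
    then show ?thesis
    proof cases
      case 1 show ?thesis by (rule *[OF 1 partial_alpha]) (intro generated_algebra_intros mem)
    next
      case 2 show ?thesis by (rule *[OF 2 partial_beta]) (intro generated_algebra_intros mem)
    next
      case 3 show ?thesis by (rule *[OF 3 partial_gamma]) (intro generated_algebra_intros mem)
    next
      case 4 show ?thesis by (rule *[OF 4 partial_mu]) (intro generated_algebra_intros mem)
    next
      case 5 show ?thesis by (rule *[OF 5 partial_nu]) (intro generated_algebra_intros mem)
    next
      case 6 show ?thesis by (rule *[OF 6 partial_tau]) (intro generated_algebra_intros mem)
    next
      case 7 show ?thesis by (rule *[OF 7 partial_component]) (intro generated_algebra_intros)
    next
      case 8 show ?thesis by (rule *[OF 8 partial_component]) (intro generated_algebra_intros)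
    next
      case 9 show ?thesis
        by (rule *[OF 9 partial_inverse_\<phi>[OF assms(2)]], assumption) (intro generated_algebra_intros mem mem_\<phi>)
    next
      case 10 show ?thesis
        by (rule *[OF 10 partial_\<sigma>[OF assms(2)]], assumption) (intro generated_algebra_intros mem mem_\<phi>)
    qed
  qed
  show ?thesis
  proof (rule smooth_on_generated_algebra[OF \<open>open U\<close> _ closed mem(10)])
    show "f differentiable (at u)" if "f \<in> H" "u \<in> U" for f u
      using that assms(2) by (auto simp: H_def differentiable_\<sigma> differentiable_inverse_\<phi>)
  qed
qed

end

section \<open>Verification that the factor has the prescribed conformal Hessian\<close>

locale flattening = flat_solution + conformal_walker U a b c "flat_solution.\<sigma> \<alpha> \<beta> \<gamma>"
  for U a b c +
  assumes positive: "u \<in> U \<Longrightarrow> \<phi> u > 0"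
    and metric_abc: "u \<in> U \<Longrightarrow> a u = I / 2 * (u $ 1)\<^sup>2 + J * u $ 1 + E * u $ 1 * u $ 2 + F * u $ 2 + K"
      "u \<in> U \<Longrightarrow> b u = - I / 2 * (u $ 2)\<^sup>2 + L * u $ 2 + M * u $ 1 * u $ 2 + N * u $ 1 + R"
      "u \<in> U \<Longrightarrow> c u = M / 2 * (u $ 1)\<^sup>2 + P * u $ 1 + E / 2 * (u $ 2)\<^sup>2 + G * u $ 2 + S"
begin

lemma partial_abc:
  assumes u: "u \<in> U"
  shows "partial 1 a u = I * u $ 1 + J + E * u $ 2" "partial 2 a u = E * u $ 1 + F"
    "partial 1 b u = M * u $ 2 + N" "partial 2 b u = - I * u $ 2 + L + M * u $ 1"
    "partial 1 c u = M * u $ 1 + P" "partial 2 c u = E * u $ 2 + G"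
  by (simp_all add: partial_cong_open[OF open_dom u metric_abc(1)] partial_cong_open[OF open_dom u metric_abc(2)]
      partial_cong_open[OF open_dom u metric_abc(3)] partial_add partial_diff partial_mult partial_power2
      partial_minus partial_divide_const)

lemma partial_partial_abc:
  assumes u: "u \<in> U"
  shows "partial 1 (partial 1 a) u = I" "partial 1 (partial 2 a) u = E" "partial 2 (partial 2 a) u = 0"
    "partial 1 (partial 1 b) u = 0" "partial 1 (partial 2 b) u = M" "partial 2 (partial 2 b) u = - I"
    "partial 1 (partial 1 c) u = M" "partial 1 (partial 2 c) u = 0" "partial 2 (partial 2 c) u = E"
  by (simp_all add: partial_cong_open[OF open_dom u partial_abc(1)] partial_cong_open[OF open_dom u partial_abc(2)]
      partial_cong_open[OF open_dom u partial_abc(3)] partial_cong_open[OF open_dom u partial_abc(4)]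
      partial_cong_open[OF open_dom u partial_abc(5)] partial_cong_open[OF open_dom u partial_abc(6)]
      partial_add partial_diff partial_mult partial_minus)

lemma weyl_flat:
  assumes u: "u \<in> U"
  shows "weyl_flat_at u"
proof -
  let ?a1 = "I * u $ 1 + J + E * u $ 2" and ?a2 = "E * u $ 1 + F" and ?b1 = "M * u $ 2 + N"
    and ?b2 = "- I * u $ 2 + L + M * u $ 1" and ?c1 = "M * u $ 1 + P" and ?c2 = "E * u $ 2 + G"
  have "b u * E - a u * M + c u * I = u $ 1 * (E * N - J * M + I * P) + u $ 2 * (E * L - F * M + I * G)
      + (E * R - K * M + I * S)"
    unfolding metric_abc[OF u] by (simp add: field_simps power2_eq_square)
  then have X: "E * b u - M * a u + I * c u = 0"
    unfolding C1[symmetric] C2[symmetric] C3[symmetric] by (simp add: mult.commute)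
  have X1: "E * ?b1 - M * ?a1 + I * ?c1 = 0" and X2: "E * ?b2 - M * ?a2 + I * ?c2 = 0"
    using C1 C2 by (simp_all add: algebra_simps)
  have "a u * (?b2 * ?c1 - ?b1 * ?c2) + b u * (?a1 * ?c2 - ?a2 * ?c1) + c u * (?a2 * ?b1 - ?a1 * ?b2) = 0"
  proof (cases "E = 0 \<and> M = 0 \<and> I = 0")
    case True
    then show ?thesis
      using C4 unfolding metric_abc[OF u] by (simp add: algebra_simps)
  next
    case False
    then show ?thesis
      using det_eq_0_if_orthogonal[OF X X1 X2] by simp
  qed
  then show ?thesis
    unfolding weyl_flat_at_iff partial_abc[OF u] partial_partial_abc[OF u]
    using X by (simp add: mult.commute)
qed

text \<open>The factor of the metric in the Hessian of \<open>\<phi>\<close>: comparing the 13-components determines it.\<close>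

definition \<kappa> :: "real^4 \<Rightarrow> real" where
  "\<kappa> u = \<tau> u - (I / 4 * u $ 1 + E / 2 * u $ 2) * \<beta> u - (M / 2 * u $ 1 - I / 4 * u $ 2) * \<gamma> u"

text \<open>Here the Pluecker relation enters: the two sides differ by twice its quadratic form.
  Geometrically, the tractor is null.\<close>

lemma norm_gradient_\<phi>:
  assumes u: "u \<in> U"
  shows "(\<Sum>k\<in>UNIV. partial k \<phi> u * (\<Sum>m\<in>UNIV. inv_metric w u k m * partial m \<phi> u)) = 2 * \<phi> u * \<kappa> u"
proof -
  have "(\<Sum>k\<in>UNIV. partial k \<phi> u * (\<Sum>m\<in>UNIV. inv_metric w u k m * partial m \<phi> u))
      = 2 * \<phi> u * \<kappa> u - 2 * (\<alpha> u * \<tau> u - \<beta> u * \<nu> u + \<gamma> u * \<mu> u)"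
    by (simp add: sum_4 inv_metric_walker partial_\<phi> metric_abc[OF u] \<phi>_def \<kappa>_def field_simps power2_eq_square)
  then show ?thesis
    by (simp add: simple)
qed

text \<open>For \<sigma> = - ln \<phi> the products of first derivatives cancel, leaving minus the
  covariant Hessian of \<phi> divided by \<phi>, and \<open>norm_gradient_\<phi>\<close> turns the
  trace term into \<kappa> / \<phi> times the metric. Each component thus becomes a linear equation
  for \<phi>.\<close>

lemma hess_eqI:
  assumes u: "u \<in> U"
    and eq: "partial i (partial j \<phi>) u - (\<Sum>k\<in>UNIV. christoffel w k i j u * partial k \<phi> u) + h * \<phi> u
      = \<kappa> u * w u i j"
  shows "hess i j u = h"
proof -
  let ?q = "inverse (\<phi> u)"
  have pos: "\<phi> u > 0"
    using positive[OF u] .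
  have "partial i (partial j \<sigma>) u = partial i (\<lambda>u. - partial j \<phi> u * inverse (\<phi> u)) u"
    using open_dom u partial_\<sigma>[OF positive] by (rule partial_cong_open)
  also have "\<dots> = partial i \<phi> u * partial j \<phi> u * (?q * ?q) - partial i (partial j \<phi>) u * ?q"
    using pos by (simp add: partial_mult partial_minus differentiable_inverse_\<phi> partial_inverse_\<phi>)
  finally have 1: "partial i (partial j \<sigma>) u = \<dots>" .
  have "(\<Sum>k\<in>UNIV. partial k \<sigma> u * gradient w \<sigma> k u)
      = (?q * ?q) * (\<Sum>k\<in>UNIV. partial k \<phi> u * (\<Sum>m\<in>UNIV. inv_metric w u k m * partial m \<phi> u))"
    by (simp add: gradient_def partial_\<sigma>[OF pos] sum_distrib_left sum_negf mult_ac)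
  also have "\<dots> = (?q * \<phi> u) * (2 * \<kappa> u * ?q)"
    unfolding norm_gradient_\<phi>[OF u] by (simp add: mult_ac)
  also have "?q * \<phi> u = 1"
    using pos by simp
  finally have 2: "(\<Sum>k\<in>UNIV. partial k \<sigma> u * gradient w \<sigma> k u) = 2 * \<kappa> u * ?q"
    by simp
  have 3: "(\<Sum>k\<in>UNIV. christoffel w k i j u * partial k \<sigma> u)
      = - ?q * (\<Sum>k\<in>UNIV. christoffel w k i j u * partial k \<phi> u)"
    by (simp add: partial_\<sigma>[OF pos] sum_distrib_left sum_negf mult_ac)
  have "hess i j u = ?q * (- partial i (partial j \<phi>) u + (\<Sum>k\<in>UNIV. christoffel w k i j u * partial k \<phi> u)
      + \<kappa> u * w u i j)"
    unfolding conformal_hessian_def 1 2 3 partial_\<sigma>[OF pos, of i] partial_\<sigma>[OF pos, of j] by (simp add: algebra_simps)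
  also have "\<dots> = ?q * (h * \<phi> u)"
    unfolding eq[symmetric] by simp
  finally show ?thesis
    using pos by simp
qed

lemma hess_flat:
  assumes u: "u \<in> U"
  shows "hess_flat_at u"
proof -
  note simps = partial_\<phi> sum_4 christoffel_w u partial_abc[OF u] \<kappa>_def \<phi>_def partial_add partial_diff partial_mult
    partial_minus partial_divide_const partial_alpha partial_beta partial_gamma partial_mu partial_nu partial_tau
  note jets = hess33_def hess34_def hess44_def partial_partial_abc[OF u] metric_abc[OF u]
  let ?C1 = "E * N - J * M + I * P" and ?C2 = "E * L - F * M + I * G" and ?C3 = "E * R - K * M + I * S"
  let ?p = "u $ 1" and ?q = "u $ 2"
  let ?N = "\<lambda>i j. partial i (partial j \<phi>) u - (\<Sum>k\<in>UNIV. christoffel w k i j u * partial k \<phi> u)"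
  have "hess 1 1 u = 0"
    by (rule hess_eqI[OF u]) (simp add: simps)
  moreover have "hess 1 2 u = 0"
    by (rule hess_eqI[OF u]) (simp add: simps)
  moreover have "hess 2 2 u = 0"
    by (rule hess_eqI[OF u]) (simp add: simps)
  moreover have "hess 1 3 u = I / 4"
    by (rule hess_eqI[OF u]) ((simp add: simps); (simp add: field_simps)?)
  moreover have "hess 1 4 u = M / 2"
    by (rule hess_eqI[OF u]) ((simp add: simps); (simp add: field_simps)?)
  moreover have "hess 2 3 u = E / 2"
    by (rule hess_eqI[OF u]) ((simp add: simps); (simp add: field_simps)?)
  moreover have "hess 2 4 u = - I / 4"
    by (rule hess_eqI[OF u]) ((simp add: simps); (simp add: field_simps)?)
  moreover have "hess 3 3 u = hess33 u"
  proof (rule hess_eqI[OF u])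
    \<comment> \<open>The components 33, 34 and 44 do not match identically; the explicit remainder
      is a combination of \<open>?C1\<close>, \<open>?C2\<close>, \<open>?C3\<close>, which are
      zero.\<close>
    have "?N 3 3 + hess33 u * \<phi> u - \<kappa> u * w u 3 3
        = ?p / 4 * (?C2 * (\<alpha> u + \<beta> u * ?p) - \<gamma> u * (?p * ?C1 + ?C3))"
      by (simp add: simps jets) (simp add: field_simps power2_eq_square)
    then show "?N 3 3 + hess33 u * \<phi> u = \<kappa> u * w u 3 3"
      unfolding C1[symmetric] C2[symmetric] C3[symmetric] by simp
  qed
  moreover have "hess 3 4 u = hess34 u"
  proof (rule hess_eqI[OF u])
    have "?N 3 4 + hess34 u * \<phi> u - \<kappa> u * w u 3 4
        = - (?C2 * ?q * (\<alpha> u + \<gamma> u * ?q) + ?C1 * ?p * (2 * \<alpha> u + \<beta> u * ?p + 2 * \<gamma> u * ?q)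
            + ?C3 * (\<alpha> u + \<gamma> u * ?q)) / 4"
      by (simp add: simps jets) (simp add: field_simps power2_eq_square)
    then show "?N 3 4 + hess34 u * \<phi> u = \<kappa> u * w u 3 4"
      unfolding C1[symmetric] C2[symmetric] C3[symmetric] by simp
  qed
  moreover have "hess 4 4 u = hess44 u"
  proof (rule hess_eqI[OF u])
    have "?N 4 4 + hess44 u * \<phi> u - \<kappa> u * w u 4 4
        = ?q / 4 * (?C2 * \<beta> u * ?q - ?C1 * (\<alpha> u + \<gamma> u * ?q) + 2 * ?C3 * \<beta> u)"
      by (simp add: simps jets) (simp add: field_simps power2_eq_square)
    then show "?N 4 4 + hess44 u * \<phi> u = \<kappa> u * w u 4 4"
      unfolding C1[symmetric] C2[symmetric] C3[symmetric] by simp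
  qed
  ultimately show ?thesis
    unfolding hess_flat_at_def partial_partial_abc[OF u] by simp
qed

lemma flat_on_conf: "flat_on U conf"
  unfolding flat_on_def using flat_atI weyl_flat hess_flat by blast

end

section \<open>Locally conformally flat Walker metrics\<close>

lemma depends_only_on_u1u2_partial:
  assumes "open Om" "depends_only_on_u1u2 Om f" "x \<in> Om" "k \<in> {3, 4}"
  shows "partial k f x = 0"
proof -
  have "open ((\<lambda>t. x + t *\<^sub>R axis k 1) -` Om)"
    by (intro open_vimage continuous_intros assms)
  then have "\<forall>\<^sub>F t in nhds (0::real). x + t *\<^sub>R axis k 1 \<in> Om"
    using \<open>x \<in> Om\<close> by (auto simp: eventually_nhds)
  moreover have "f (x + t *\<^sub>R axis k 1) = f x" if "x + t *\<^sub>R axis k 1 \<in> Om" for t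
  proof -
    have "axis k (1::real) $ 1 = 0" "axis k (1::real) $ 2 = 0"
      using assms(4) by (auto simp: axis_def)
    then have "(x + t *\<^sub>R axis k 1) $ 1 = x $ 1 \<and> (x + t *\<^sub>R axis k 1) $ 2 = x $ 2"
      by simp
    with assms(2,3) that show ?thesis
      unfolding depends_only_on_u1u2_def by blast
  qed
  ultimately have "\<forall>\<^sub>F t in nhds (0::real). f (x + t *\<^sub>R axis k 1) = f x"
    by (auto elim: eventually_mono)
  then have "partial k f x = deriv (\<lambda>t::real. f x) 0"
    unfolding partial_def by (intro deriv_cong_ev) auto
  then show ?thesis by simp
qed

section \<open>Existence of a flattening factor near each point\<close>

context flat_constants
begin

lemma flattening_neighbourhood:
  assumes "walker Om a b c" "p \<in> Om"
    and abc: "\<And>u. u \<in> Om \<Longrightarrow> a u = I / 2 * (u $ 1)\<^sup>2 + J * u $ 1 + E * u $ 1 * u $ 2 + F * u $ 2 + K"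
      "\<And>u. u \<in> Om \<Longrightarrow> b u = - I / 2 * (u $ 2)\<^sup>2 + L * u $ 2 + M * u $ 1 * u $ 2 + N * u $ 1 + R"
      "\<And>u. u \<in> Om \<Longrightarrow> c u = M / 2 * (u $ 1)\<^sup>2 + P * u $ 1 + E / 2 * (u $ 2)\<^sup>2 + G * u $ 2 + S"
  shows "\<exists>U \<sigma>. open U \<and> p \<in> U \<and> U \<subseteq> Om \<and> smooth_on U \<sigma> \<and>
        flat_on U (\<lambda>x i j. exp (2 * \<sigma> x) * walker_metric a b c x i j)"
proof -
  interpret walker Om a b c by fact
  obtain \<alpha> \<beta> \<gamma> \<mu> \<nu> \<tau> where sol: "flat_solution E F G I J K L M N P R S \<alpha> \<beta> \<gamma> \<mu> \<nu> \<tau>"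
    and p: "\<alpha> p = 1" "\<beta> p = 0" "\<gamma> p = 0"
    by (rule flat_solution_exists[of p])
  interpret flat_solution E F G I J K L M N P R S \<alpha> \<beta> \<gamma> \<mu> \<nu> \<tau> by fact
  \<comment> \<open>The logarithm of \<phi> requires positivity; \<open>\<phi> p = 1\<close> and
    continuity provide a neighbourhood of \<open>p\<close>.\<close>
  define U where "U = Om \<inter> {u. \<phi> u > 0}"
  have "continuous_on UNIV \<phi>"
    by (intro continuous_at_imp_continuous_on ballI differentiable_imp_continuous_within) simp
  then have "open U"
    unfolding U_def by (intro open_Int open_dom open_Collect_less) auto
  moreover have "p \<in> U"
    using \<open>p \<in> Om\<close> p by (simp add: U_def \<phi>_def)
  moreover have "smooth_on U \<sigma>"
    using \<open>open U\<close> by (rule smooth_on_\<sigma>) (simp add: U_def)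
  moreover interpret V: flattening E F G I J K L M N P R S \<alpha> \<beta> \<gamma> \<mu> \<nu> \<tau> U a b c
    using \<open>open U\<close> \<open>smooth_on U \<sigma>\<close> smooth indep abc
    by unfold_locales (auto simp: U_def intro: smooth_on_subset)
  have "flat_on U (\<lambda>x i j. exp (2 * \<sigma> x) * walker_metric a b c x i j)"
    by (rule V.flat_on_conf)
  ultimately show ?thesis
    by (auto simp: U_def)
qed

end

text \<open>The primitive is an explicit quadratic polynomial, so integration is a comparison of
  gradients on a connected open set. The shared coefficient \<open>B\<close> is the symmetry of the
  mixed derivative.\<close>

lemma affine_on_connected:
  fixes f :: "real^4 \<Rightarrow> real"
  assumes "open U" "connected U" "\<And>x. x \<in> U \<Longrightarrow> f differentiable (at x)"
    and "\<And>x. x \<in> U \<Longrightarrow> partial 1 f x = A * x $ 1 + B * x $ 2 + C"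
    and "\<And>x. x \<in> U \<Longrightarrow> partial 2 f x = B * x $ 1 + D * x $ 2 + H"
    and "\<And>x. x \<in> U \<Longrightarrow> partial 3 f x = 0" "\<And>x. x \<in> U \<Longrightarrow> partial 4 f x = 0"
  shows "\<exists>k. \<forall>x\<in>U. f x = A / 2 * (x $ 1)\<^sup>2 + B * x $ 1 * x $ 2 + D / 2 * (x $ 2)\<^sup>2 + C * x $ 1 + H * x $ 2 + k"
proof -
  let ?q = "\<lambda>x::real^4. A / 2 * (x $ 1)\<^sup>2 + B * x $ 1 * x $ 2 + D / 2 * (x $ 2)\<^sup>2 + C * x $ 1 + H * x $ 2"
  have "\<exists>k. \<forall>x\<in>U. f x - ?q x = k"
  proof (rule partial_zero_imp_constant[OF assms(1,2)])
    fix x k assume x: "x \<in> U"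
    show "(\<lambda>x. f x - ?q x) differentiable (at x)"
      using assms(3)[OF x] by simp
    have "\<forall>k. partial k (\<lambda>x. f x - ?q x) x = 0"
      unfolding forall_4 using x assms
      by (simp add: partial_diff partial_add partial_mult partial_power2 partial_divide_const)
    then show "partial k (\<lambda>x. f x - ?q x) x = 0" ..
  qed
  then obtain k where "\<And>x. x \<in> U \<Longrightarrow> f x - ?q x = k"
    by blast
  then show ?thesis
    by (intro exI[of _ k]) (auto simp: algebra_simps)
qed

section \<open>From the Weyl equations to the polynomial normal form\<close>

context walker
begin

lemma conformally_flat_imp_weyl_flat:
  assumes "locally_conformally_flat U w" "u \<in> U"
  shows "weyl_flat_at u"
proof -
  obtain V \<sigma> where V: "open V" "u \<in> V" "V \<subseteq> U" "smooth_on V \<sigma>"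
    "flat_on V (\<lambda>x i j. exp (2 * \<sigma> x) * w x i j)"
    using assms unfolding locally_conformally_flat_def by blast
  interpret V: conformal_walker V a b c \<sigma>
    using V smooth indep by unfold_locales (auto intro: smooth_on_subset)
  show ?thesis
    using V.flat_at_imp[OF V(2)] V(5,2) unfolding flat_on_def by blast
qed

text \<open>The linear Weyl equations are of finite type. With subscripts for derivatives, - a111 =
  b122 = c112 = 0 and a112 = c122 = 0, while a122, b112 and b122 follow from a22 = 0, b11 = 0 and
  b22 = - a11.\<close>

lemma third_partials_zero:
  assumes flat: "\<And>u. u \<in> U \<Longrightarrow> weyl_flat_at u" and u: "u \<in> U"
  shows "partial k (partial 1 (partial 1 a)) u = 0" "partial k (partial 1 (partial 2 a)) u = 0"
    "partial k (partial 1 (partial 2 b)) u = 0"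
proof -
  note eqs = flat[unfolded weyl_flat_at_iff]
  have comm: "partial i (partial j f) u = partial j (partial i f) u"
    and comm2: "partial i (partial j (partial k f)) u = partial j (partial i (partial k f)) u"
    and comm3: "partial i (partial j (partial k f)) u = partial i (partial k (partial j f)) u"
    if "smooth_on U f" for i j k f
  proof -
    show "partial i (partial j f) u = partial j (partial i f) u"
      using smooth_on_partial_commute[OF that open_dom u] .
    show "partial i (partial j (partial k f)) u = partial j (partial i (partial k f)) u"
      using smooth_on_partial_commute[OF smooth_on_partial[OF that] open_dom u] .
    show "partial i (partial j (partial k f)) u = partial i (partial k (partial j f)) u"
      by (rule partial_cong_open[OF open_dom u]) (rule smooth_on_partial_commute[OF that open_dom])
  qed
  have zero: "partial i f u = 0" if "\<And>x. x \<in> U \<Longrightarrow> f x = 0" for i f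
    using partial_cong_open[OF open_dom u that, where k=i] by simp
  have eq: "partial i f u = partial i g u" if "\<And>x. x \<in> U \<Longrightarrow> f x = g x" for i f g
    using partial_cong_open[OF open_dom u that] .
  have b22: "partial i (partial 2 (partial 2 b)) u = - partial i (partial 1 (partial 1 a)) u" for i
  proof -
    have "partial i (partial 2 (partial 2 b)) u = partial i (\<lambda>x. - partial 1 (partial 1 a) x) u"
      by (rule eq) (use eqs in blast)
    then show ?thesis
      using smooth_on_imp_differentiable[OF smooth_on_partial[OF smooth_on_partial[OF smooth(1)]] open_dom u]
      by (simp add: partial_minus)
  qed
  have a22: "partial i (partial 2 (partial 2 a)) u = 0" and b11: "partial i (partial 1 (partial 1 b)) u = 0"
    and c12: "partial i (partial 1 (partial 2 c)) u = 0" for i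
    using eqs by (auto intro!: zero)
  have c11: "partial i (partial 1 (partial 1 c)) u = partial i (partial 1 (partial 2 b)) u"
    and c22: "partial i (partial 2 (partial 2 c)) u = partial i (partial 1 (partial 2 a)) u" for i
    using eqs by (auto intro!: eq)
  have a111: "partial 1 (partial 1 (partial 1 a)) u = 0"
    using b22[of 1] c11[of 2] c12[of 1] comm2[OF smooth(2), of 1 2 2] comm2[OF smooth(3), of 2 1 1]
      comm3[OF smooth(3), of 1 2 1] by simp
  have a112: "partial 2 (partial 1 (partial 1 a)) u = 0"
    using c22[of 1] c12[of 2] comm2[OF smooth(1), of 2 1 1] comm3[OF smooth(1), of 1 2 1]
      comm2[OF smooth(3), of 1 2 2] by simp
  have a121: "partial 1 (partial 1 (partial 2 a)) u = 0"
    using a112 comm2[OF smooth(1), of 2 1 1] comm3[OF smooth(1), of 1 2 1] by simp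
  have a122: "partial 2 (partial 1 (partial 2 a)) u = 0"
    using a22[of 1] comm2[OF smooth(1), of 2 1 2] by simp
  have b121: "partial 1 (partial 1 (partial 2 b)) u = 0"
    using b11[of 2] comm2[OF smooth(2), of 2 1 1] comm3[OF smooth(2), of 1 2 1] by simp
  have b122: "partial 2 (partial 1 (partial 2 b)) u = 0"
    using b22[of 1] a111 comm2[OF smooth(2), of 2 1 2] by simp
  have "partial k (partial i (partial j f)) u = 0" if "k \<in> {3, 4}" "f \<in> {a, b, c}" for i j k f
  proof -
    have "smooth_on U f"
      using that smooth by auto
    then have "partial k (partial i (partial j f)) u = partial i (partial k (partial j f)) u"
      by (rule comm2)
    also have "\<dots> = 0"
      using partial_mixed_zero(3)[OF _ that] by (intro zero) auto
    finally show ?thesis .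
  qed
  then have "\<forall>k. partial k (partial 1 (partial 1 a)) u = 0 \<and> partial k (partial 1 (partial 2 a)) u = 0
      \<and> partial k (partial 1 (partial 2 b)) u = 0"
    unfolding forall_4 using a111 a112 a121 a122 b121 b122 by simp
  then show "partial k (partial 1 (partial 1 a)) u = 0" "partial k (partial 1 (partial 2 a)) u = 0"
    "partial k (partial 1 (partial 2 b)) u = 0" by auto
qed

lemma weyl_flat_imp_polynomial:
  assumes conn: "connected U" and ne: "U \<noteq> {}" and flat: "\<And>u. u \<in> U \<Longrightarrow> weyl_flat_at u"
  obtains E F G I J K L M N P R S where "flat_constants E F G I J K L M N P R S"
    and "\<And>u. u \<in> U \<Longrightarrow> a u = I / 2 * (u $ 1)\<^sup>2 + J * u $ 1 + E * u $ 1 * u $ 2 + F * u $ 2 + K"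
    and "\<And>u. u \<in> U \<Longrightarrow> b u = - I / 2 * (u $ 2)\<^sup>2 + L * u $ 2 + M * u $ 1 * u $ 2 + N * u $ 1 + R"
    and "\<And>u. u \<in> U \<Longrightarrow> c u = M / 2 * (u $ 1)\<^sup>2 + P * u $ 1 + E / 2 * (u $ 2)\<^sup>2 + G * u $ 2 + S"
proof -
  note eqs = flat[unfolded weyl_flat_at_iff]
  have diff: "f differentiable (at x)" "partial i f differentiable (at x)" "partial i (partial j f) differentiable (at x)"
    if "x \<in> U" "f \<in> {a, b, c}" for x f i j
    using that smooth by (auto intro!: smooth_on_imp_differentiable[OF _ open_dom] smooth_on_partial)
  note const = partial_zero_imp_constant[OF open_dom conn] and affine = affine_on_connected[OF open_dom conn]
  obtain I where I: "\<And>x. x \<in> U \<Longrightarrow> partial 1 (partial 1 a) x = I"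
    using const[OF diff(3) third_partials_zero(1)[OF flat]] by auto
  obtain E where E: "\<And>x. x \<in> U \<Longrightarrow> partial 1 (partial 2 a) x = E"
    using const[OF diff(3) third_partials_zero(2)[OF flat]] by auto
  obtain M where M: "\<And>x. x \<in> U \<Longrightarrow> partial 1 (partial 2 b) x = M"
    using const[OF diff(3) third_partials_zero(3)[OF flat]] by auto
  \<comment> \<open>\<open>affine\<close> with vanishing quadratic coefficients: a first derivative
    with constant gradient is affine in \<open>x $ 1\<close>, \<open>x $ 2\<close>.\<close>
  have first: "\<exists>k. \<forall>x\<in>U. partial i f x = A * x $ 1 + B * x $ 2 + k"
    if "f \<in> {a, b, c}" "\<And>x. x \<in> U \<Longrightarrow> partial 1 (partial i f) x = A"
      "\<And>x. x \<in> U \<Longrightarrow> partial 2 (partial i f) x = B" for f i A B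
    using affine[of "partial i f" 0 0 A 0 B] that by (simp add: diff partial_mixed_zero)
  have "\<exists>k. \<forall>x\<in>U. partial 1 a x = I * x $ 1 + E * x $ 2 + k"
    by (rule first) (simp_all add: I E)
  then obtain J where a1: "\<And>x. x \<in> U \<Longrightarrow> partial 1 a x = I * x $ 1 + E * x $ 2 + J" by blast
  have "\<exists>k. \<forall>x\<in>U. partial 2 a x = E * x $ 1 + 0 * x $ 2 + k"
    by (rule first) (simp_all add: E eqs)
  then obtain F where a2: "\<And>x. x \<in> U \<Longrightarrow> partial 2 a x = E * x $ 1 + 0 * x $ 2 + F" by blast
  have "\<exists>k. \<forall>x\<in>U. partial 1 b x = 0 * x $ 1 + M * x $ 2 + k"
    by (rule first) (simp_all add: M eqs)
  then obtain N where b1: "\<And>x. x \<in> U \<Longrightarrow> partial 1 b x = 0 * x $ 1 + M * x $ 2 + N" by blast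
  have "\<exists>k. \<forall>x\<in>U. partial 2 b x = M * x $ 1 + - I * x $ 2 + k"
    by (rule first) (simp_all add: M I eqs)
  then obtain L where b2: "\<And>x. x \<in> U \<Longrightarrow> partial 2 b x = M * x $ 1 + - I * x $ 2 + L" by blast
  have "\<exists>k. \<forall>x\<in>U. partial 1 c x = M * x $ 1 + 0 * x $ 2 + k"
    by (rule first) (simp_all add: M eqs)
  then obtain P where c1: "\<And>x. x \<in> U \<Longrightarrow> partial 1 c x = M * x $ 1 + 0 * x $ 2 + P" by blast
  have "\<exists>k. \<forall>x\<in>U. partial 2 c x = 0 * x $ 1 + E * x $ 2 + k"
    by (rule first) (simp_all add: E eqs)
  then obtain G where c2: "\<And>x. x \<in> U \<Longrightarrow> partial 2 c x = 0 * x $ 1 + E * x $ 2 + G" by blast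
  obtain K where a: "\<And>x. x \<in> U \<Longrightarrow> a x = I / 2 * (x $ 1)\<^sup>2 + E * x $ 1 * x $ 2 + 0 / 2 * (x $ 2)\<^sup>2 + J * x $ 1 + F * x $ 2 + K"
    using affine[of a, OF _ a1 a2] by (auto simp: diff)
  obtain R where b: "\<And>x. x \<in> U \<Longrightarrow> b x = 0 / 2 * (x $ 1)\<^sup>2 + M * x $ 1 * x $ 2 + - I / 2 * (x $ 2)\<^sup>2 + N * x $ 1 + L * x $ 2 + R"
    using affine[of b, OF _ b1 b2] by (auto simp: diff)
  obtain S where c: "\<And>x. x \<in> U \<Longrightarrow> c x = M / 2 * (x $ 1)\<^sup>2 + 0 * x $ 1 * x $ 2 + E / 2 * (x $ 2)\<^sup>2 + P * x $ 1 + G * x $ 2 + S"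
    using affine[of c, OF _ c1 c2] by (auto simp: diff)
  obtain u where u: "u \<in> U" using ne by blast
  have X: "E * b x - M * a x + I * c x = 0" if "x \<in> U" for x
    using eqs[OF that] I[OF that] E[OF that] M[OF that] by (simp add: mult.commute)
  \<comment> \<open>The origin need not lie in \<open>U\<close>, so coefficients are compared at
    \<open>u\<close>: the derivatives of the identity \<open>X\<close> give the first two
    conditions, the quadratic coefficients cancelling, and its value at \<open>u\<close> then gives
    the third.\<close>
  have dX: "E * partial k b u - M * partial k a u + I * partial k c u = 0" for k
  proof -
    have "partial k (\<lambda>x. E * b x - M * a x + I * c x) u = partial k (\<lambda>_. 0) u"
      using open_dom u X by (rule partial_cong_open)
    then show ?thesis
      using u by (simp add: partial_add partial_diff partial_mult)
  qed
  have C1: "0 = E * N - J * M + I * P"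
    using dX[of 1] unfolding a1[OF u] b1[OF u] c1[OF u] by (simp add: algebra_simps)
  have C2: "0 = E * L - F * M + I * G"
    using dX[of 2] unfolding a2[OF u] b2[OF u] c2[OF u] by (simp add: algebra_simps)
  have "E * b u - M * a u + I * c u = u $ 1 * (E * N - J * M + I * P) + u $ 2 * (E * L - F * M + I * G)
      + (E * R - K * M + I * S)"
    unfolding a[OF u] b[OF u] c[OF u] by (simp add: field_simps power2_eq_square)
  then have C3: "0 = E * R - K * M + I * S"
    unfolding X[OF u] C1[symmetric] C2[symmetric] by simp
  have C4: "0 = K * (L * P - N * G) + R * (J * G - F * P) + S * (F * N - J * L)"
  proof (cases "E = 0 \<and> M = 0 \<and> I = 0")
    \<comment> \<open>Now \<open>a\<close>, \<open>b\<close>, \<open>c\<close> are affine on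
      \<open>U\<close>, and the determinant at \<open>u\<close> equals the determinant of their
      coefficients because column operations remove \<open>u $ 1\<close> and
      \<open>u $ 2\<close>.\<close>
    case True
    have "a u * (partial 2 b u * partial 1 c u - partial 1 b u * partial 2 c u)
      + b u * (partial 1 a u * partial 2 c u - partial 2 a u * partial 1 c u)
      + c u * (partial 2 a u * partial 1 b u - partial 1 a u * partial 2 b u) = 0"
      using eqs[OF u] by blast
    then show ?thesis
      unfolding a[OF u] b[OF u] c[OF u] a1[OF u] a2[OF u] b1[OF u] b2[OF u] c1[OF u] c2[OF u]
      using True by (simp add: algebra_simps)
  next
    \<comment> \<open>The first three conditions make the coefficient vectors orthogonal to a
      nonzero vector, so the lemma applies to the coefficients themselves.\<close>
    case False
    then show ?thesis
      using det_eq_0_if_orthogonal[of E R M K I S N J P L F G] C1 C2 C3 by (simp add: algebra_simps)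
  qed
  show ?thesis
    by (rule that[of E F G I J K L M N P R S])
      (use C1 C2 C3 C4 a b c in \<open>auto simp: flat_constants_def\<close>)
qed

end

theorem theorem5p1:
  fixes Om :: "(real^4) set" and a b c :: "real^4 \<Rightarrow> real"
  assumes "open Om" and "connected Om" and "Om \<noteq> {}"
    and "smooth_on Om a" and "smooth_on Om b" and "smooth_on Om c"
    and "depends_only_on_u1u2 Om a" and "depends_only_on_u1u2 Om b" and "depends_only_on_u1u2 Om c"
  shows "locally_conformally_flat Om (walker_metric a b c) \<longleftrightarrow>
    (\<exists>E F G H I J K L M N P Q R :: real.
       0 = E * N - J * M + I * P \<and>
       0 = E * L - F * M + I * G \<and>
       0 = E * R - K * M + I * (H + Q) \<and>
       0 = K * (L * P - N * G) + R * (J * G - F * P) + (Q + H) * (F * N - J * L) \<and>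
       (\<forall>u\<in>Om.
          a u = I / 2 * (u$1)^2 + J * u$1 + E * u$1 * u$2 + F * u$2 + K \<and>
          b u = - I / 2 * (u$2)^2 + L * u$2 + M * u$1 * u$2 + N * u$1 + R \<and>
          c u = M / 2 * (u$1)^2 + P * u$1 + E / 2 * (u$2)^2 + G * u$2 + (Q + H)))"
    (is "?L \<longleftrightarrow> ?R")
proof
  interpret walker Om a b c
    using assms depends_only_on_u1u2_partial by unfold_locales blast+
  show ?R if lcf: ?L
  proof -
    obtain E F G I J K L M N P R S where "flat_constants E F G I J K L M N P R S"
      "\<And>u. u \<in> Om \<Longrightarrow> a u = I / 2 * (u $ 1)\<^sup>2 + J * u $ 1 + E * u $ 1 * u $ 2 + F * u $ 2 + K"
      "\<And>u. u \<in> Om \<Longrightarrow> b u = - I / 2 * (u $ 2)\<^sup>2 + L * u $ 2 + M * u $ 1 * u $ 2 + N * u $ 1 + R"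
      "\<And>u. u \<in> Om \<Longrightarrow> c u = M / 2 * (u $ 1)\<^sup>2 + P * u $ 1 + E / 2 * (u $ 2)\<^sup>2 + G * u $ 2 + S"
      using weyl_flat_imp_polynomial[OF assms(2,3) conformally_flat_imp_weyl_flat[OF lcf]] by blast
    note sol = this[unfolded flat_constants_def]
    \<comment> \<open>Only Q + H occurs, so the constant term \<open>S\<close> of \<open>c\<close>
      is assigned to Q and H is taken to be 0.\<close>
    show ?R
      by (rule exI[of _ E], rule exI[of _ F], rule exI[of _ G], rule exI[of _ 0],
          rule exI[of _ I], rule exI[of _ J], rule exI[of _ K], rule exI[of _ L],
          rule exI[of _ M], rule exI[of _ N], rule exI[of _ P], rule exI[of _ S],
          rule exI[of _ R]) (use sol in simp)
  qed
  show ?L if ?R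
  proof -
    from that obtain E F G H I J K L M N P Q R where
      C: "0 = E * N - J * M + I * P" "0 = E * L - F * M + I * G" "0 = E * R - K * M + I * (Q + H)"
        "0 = K * (L * P - N * G) + R * (J * G - F * P) + (Q + H) * (F * N - J * L)"
      and abc: "\<And>u. u \<in> Om \<Longrightarrow> a u = I / 2 * (u $ 1)\<^sup>2 + J * u $ 1 + E * u $ 1 * u $ 2 + F * u $ 2 + K"
        "\<And>u. u \<in> Om \<Longrightarrow> b u = - I / 2 * (u $ 2)\<^sup>2 + L * u $ 2 + M * u $ 1 * u $ 2 + N * u $ 1 + R"
        "\<And>u. u \<in> Om \<Longrightarrow> c u = M / 2 * (u $ 1)\<^sup>2 + P * u $ 1 + E / 2 * (u $ 2)\<^sup>2 + G * u $ 2 + (Q + H)"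
      by (auto simp: add.commute)
    interpret flat_constants E F G I J K L M N P R "Q + H"
      using C by unfold_locales
    show ?L
      unfolding locally_conformally_flat_def
      using flattening_neighbourhood[OF walker_axioms _ abc] by blast
  qed
qed

end
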